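(* There are exactly four projective equivalence classes of smooth plane cubics $V(f)\subset\mathbb{P}^2$, $f\in\mathbb{C}[x,y,z]$ homogeneous of degree $3$, such that the Macaulay polynomial $\mathrm{Mac}(f)$ and the Hessian polynomial $\mathrm{Hess}(f)$ are projectively equivalent. They are the ones corresponding to the values $0$, $64$, $\omega$ and $\overline{\omega}$ of the $j$-invariant $j(f)$, where $\omega=352+96\sqrt{15}\,i$.
   Context: Projective equivalence: two nonzero homogeneous polynomials $p,q$ of the same degree in $\mathbb{C}[x,y,z]$ are projectively equivalent if one is obtained from the other by an invertible linear change of variables, up to a nonzero scalar, i.e. $q(\overline{x})=c\,p(B\overline{x})$ for some $B\in GL_3(\mathbb{C})$ and $c\in\mathbb{C}\setminus\{0\}$. Two cubics are projectively equivalent if their defining polynomials are. Hessian polynomial: $\mathrm{Hess}(f)$ is the determinant of the $3\times 3$ matrix of second-order partial derivatives of $f$, considered up to nonzero scalar multiplication. Macaulay polynomial: let the polynomial ring act on itself by differentiation, $p\cdot g:=p\left(\frac{\partial}{\partial x},\frac{\partial}{\partial y},\frac{\partial}{\partial z}\right)(g)$, and for $g\neq 0$ let $g^{\perp}:=\{p\in\mathbb{C}[x,y,z] : p\cdot g=0\}$. Let $J(f)=\left(\frac{\partial f}{\partial x},\frac{\partial f}{\partial y},\frac{\partial f}{\partial z}\right)$ be the Jacobian ideal of $f$. For $f$ a smooth cubic, $\mathbb{C}[x,y,z]/J(f)$ is a graded Artinian Gorenstein local ring of socle degree $3$, and by a theorem of Macaulay there is a homogeneous polynomial $g$ of degree $3$,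 unique up to nonzero scalar, with $J(f)=g^{\perp}$. This $g$ is denoted $\mathrm{Mac}(f)$. $j$-invariant: every smooth plane cubic is projectively equivalent to one of the form $f_a=x^3+y^3+z^3-3axyz$ with $a\in\mathbb{C}$, $a^3\neq 1$. The $j$-invariant is normalized so that $j(f_a)=-\frac{a^3(a^3+8)^3}{(1-a^3)^3}$; it depends only on the projective equivalence class, and two smooth plane cubics are projectively equivalent if and only if they have the same $j$-invariant. *)

theory Defs
  imports "HOL-Analysis.Analysis" "HOL-Library.Poly_Mapping"
begin

text \<open>
  Polynomials in \<open>\<complex>[x,y,z]\<close> are finitely supported coefficient functions on exponent vectors.
  The variables are indexed by the three-element type \<open>3\<close>, whose elements are
  \<open>1\<close>, \<open>2\<close> and \<open>3 = 0\<close>, so that linear changes of variables are elements of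
  \<open>complex ^ 3 ^ 3\<close>.
\<close>

type_synonym tpoly = "(3 \<Rightarrow>\<^sub>0 nat) \<Rightarrow>\<^sub>0 complex"

definition Var :: "3 \<Rightarrow> tpoly" where
  "Var i = Poly_Mapping.single (Poly_Mapping.single i 1) 1"

definition Const :: "complex \<Rightarrow> tpoly" where
  "Const c = Poly_Mapping.single 0 c"

definition homogeneous :: "nat \<Rightarrow> tpoly \<Rightarrow> bool" where
  "homogeneous d p \<longleftrightarrow>
     (\<forall>m\<in>Poly_Mapping.keys p. (\<Sum>i\<in>UNIV. Poly_Mapping.lookup m i) = d)"

text \<open>
  \<open>subst_poly h s p\<close> replaces each coefficient \<open>c\<close> of \<open>p\<close> by \<open>h c\<close> and the \<open>i\<close>-th
  variable by \<open>s i\<close>; both evaluation at a point and linear substitution are instances.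
\<close>

definition subst_poly :: "(complex \<Rightarrow> 'b) \<Rightarrow> (3 \<Rightarrow> 'b) \<Rightarrow> tpoly \<Rightarrow> 'b::comm_ring_1" where
  "subst_poly h s p =
     (\<Sum>m\<in>Poly_Mapping.keys p.
        h (Poly_Mapping.lookup p m) * (\<Prod>i\<in>UNIV. s i ^ Poly_Mapping.lookup m i))"

definition eval_at :: "tpoly \<Rightarrow> complex ^ 3 \<Rightarrow> complex" where
  "eval_at p v = subst_poly (\<lambda>c. c) (\<lambda>i. v $ i) p"

definition lin_subst :: "complex ^ 3 ^ 3 \<Rightarrow> tpoly \<Rightarrow> tpoly" where
  "lin_subst B p = subst_poly Const (\<lambda>i. \<Sum>j\<in>UNIV. Const (B $ i $ j) * Var j) p"

definition proj_equiv :: "tpoly \<Rightarrow> tpoly \<Rightarrow> bool" where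
  "proj_equiv p q \<longleftrightarrow>
     p \<noteq> 0 \<and> q \<noteq> 0 \<and> (\<exists>d. homogeneous d p \<and> homogeneous d q) \<and>
     (\<exists>B c. invertible B \<and> c \<noteq> 0 \<and> q = Const c * lin_subst B p)"

text \<open>
  In \<open>pdiff\<close> the subtraction of exponents is truncated, but where truncation takes
  effect the coefficient is zero.
\<close>

definition pdiff :: "3 \<Rightarrow> tpoly \<Rightarrow> tpoly" where
  "pdiff i p =
     (\<Sum>m\<in>Poly_Mapping.keys p.
        Poly_Mapping.single (m - Poly_Mapping.single i 1)
          (of_nat (Poly_Mapping.lookup m i) * Poly_Mapping.lookup p m))"

definition smooth_cubic :: "tpoly \<Rightarrow> bool" where
  "smooth_cubic f \<longleftrightarrow>
     f \<noteq> 0 \<and> homogeneous 3 f \<and>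
     (\<forall>v. v \<noteq> 0 \<and> eval_at f v = 0 \<longrightarrow> (\<exists>i. eval_at (pdiff i f) v \<noteq> 0))"

definition Hess :: "tpoly \<Rightarrow> tpoly" where
  "Hess f = det (\<chi> i j. pdiff i (pdiff j f))"

definition diff_act :: "tpoly \<Rightarrow> tpoly \<Rightarrow> tpoly" where
  "diff_act p g =
     (\<Sum>m\<in>Poly_Mapping.keys p.
        Const (Poly_Mapping.lookup p m) *
        (pdiff 1 ^^ Poly_Mapping.lookup m 1)
          ((pdiff 2 ^^ Poly_Mapping.lookup m 2)
            ((pdiff 3 ^^ Poly_Mapping.lookup m 3) g)))"

definition perp :: "tpoly \<Rightarrow> tpoly set" where
  "perp g = {p. diff_act p g = 0}"

definition jacobian_ideal :: "tpoly \<Rightarrow> tpoly set" where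
  "jacobian_ideal f = {\<Sum>i\<in>UNIV. h i * pdiff i f | h. True}"

text \<open>
  For a smooth cubic such a polynomial exists and is unique up to a nonzero scalar
  (Macaulay), so the choice does not affect its projective equivalence class.
\<close>

definition Mac :: "tpoly \<Rightarrow> tpoly" where
  "Mac f = (SOME g. g \<noteq> 0 \<and> homogeneous 3 g \<and> jacobian_ideal f = perp g)"

definition hesse_cubic :: "complex \<Rightarrow> tpoly" where
  "hesse_cubic a =
     Var 1 ^ 3 + Var 2 ^ 3 + Var 3 ^ 3 - Const (3 * a) * Var 1 * Var 2 * Var 3"

text \<open>
  This normalization takes the value \<open>64\<close> where the classical one takes \<open>1728\<close>.
\<close>

definition j_inv :: "tpoly \<Rightarrow> complex" where
  "j_inv f =
     (THE v. \<exists>a. a ^ 3 \<noteq> 1 \<and> proj_equiv f (hesse_cubic a) \<and>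
        v = - (a ^ 3 * (a ^ 3 + 8) ^ 3 / (1 - a ^ 3) ^ 3))"

definition cubic_equiv_rel :: "(tpoly \<times> tpoly) set" where
  "cubic_equiv_rel = {(f, g). smooth_cubic f \<and> smooth_cubic g \<and> proj_equiv f g}"

definition Mac_Hess_cubics :: "tpoly set" where
  "Mac_Hess_cubics = {f. smooth_cubic f \<and> proj_equiv (Mac f) (Hess f)}"

definition j_omega :: complex where
  "j_omega = 352 + 96 * complex_of_real (sqrt 15) * \<i>"

end

theory Submission
  imports Defs "HOL-Computational_Algebra.Fundamental_Theorem_Algebra"
begin

text \<open>
  Every smooth cubic is projectively equivalent to a member \<open>f\<^sub>a = x\<^sup>3 + y\<^sup>3 + z\<^sup>3 - 3axyz\<close> of the Hesse
  pencil spanned by \<open>x\<^sup>3 + y\<^sup>3 + z\<^sup>3\<close> and \<open>xyz\<close>, and both constructions stay inside that pencil: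
  the Hessian of \<open>f\<^sub>a\<close> is \<open>-54a\<^sup>2(x\<^sup>3 + y\<^sup>3 + z\<^sup>3) + (216 - 54a\<^sup>3)xyz\<close>, and its Macaulay polynomial
  is \<open>a(x\<^sup>3 + y\<^sup>3 + z\<^sup>3) + 6xyz\<close>. The Hessian is a covariant (\<open>Hess_lin_subst\<close>) and the Macaulay
  polynomial a contravariant (\<open>jacobian_ideal_eq_perp_lin_subst\<close>), so their projective classes
  depend only on the class of the cubic, and the problem reduces to Hesse cubics.

  For \<open>J = j(f\<^sub>a)\<close> different from zero both polynomials are again multiples of smooth
  Hesse cubics, with \<open>j(Mac) = 4096 / J\<close> and \<open>j(Hess) = (256 - J)\<^sup>3 / (27 J\<^sup>2)\<close>
  (\<open>hesse_j_Mac_Hess\<close>). They agree exactly when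
  \<open>(J - 64)(J\<^sup>2 - 704 J + 262144) = 0\<close>, and the quadratic factor has the roots \<open>\<omega>\<close> and its conjugate.
  For \<open>J = 0\<close> the cubic is equivalent to the Fermat cubic, where both polynomials are
  multiples of \<open>xyz\<close>.

  The remaining content is the classical classification of plane cubics by \<open>j\<close>.
  A cubic form and its Hessian have a common zero, by a norm computation and the
  fundamental theorem of algebra; at a smooth point of the cubic such a zero is a flex, and
  a flex brings the cubic to Weierstrass form. A Hesse cubic is brought to Weierstrass form through
  its flex \<open>(1 : -1 : 0)\<close>, and Weierstrass cubics with the same \<open>j\<close> differ by a
  rescaling of the coordinates. Conversely, a linear map between two Hesse cubics
  preserves the whole Hesse pencil because it commutes with the Hessian up to scalars. On the
  pencil it preserves, up to scalar, the binary quartic that describes the four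
  triangles, and \<open>j\<close> is a quotient of covariants of that quartic
  (\<open>quartic_invariance\<close>, \<open>hesse_j_proj_invariant\<close>).
\<close>

section \<open>Polynomials in three variables\<close>

lemma Const_0 [simp]: "Const 0 = 0" by (simp add: Const_def)
lemma Const_1 [simp]: "Const 1 = 1" by (simp add: Const_def)
lemma Const_add: "Const (a + b) = Const a + Const b" by (simp add: Const_def single_add)
lemma Const_mult: "Const (a * b) = Const a * Const b" by (simp add: Const_def mult_single)
lemma Const_uminus: "Const (- a) = - Const a" by (simp add: Const_def single_uminus)
lemma Const_diff: "Const (a - b) = Const a - Const b" by (simp add: Const_def single_diff)
lemma Const_numeral [simp]: "Const (numeral k) = numeral k" by (simp add: Const_def)
lemma Const_of_nat [simp]: "Const (of_nat k) = of_nat k" by (simp add: Const_def)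

lemma single_induct [case_names zero single add]:
  assumes "P (0 :: 'a \<Rightarrow>\<^sub>0 'b::comm_monoid_add)"
    and "\<And>m c. P (Poly_Mapping.single m c)"
    and "\<And>p q. P p \<Longrightarrow> P q \<Longrightarrow> P (p + q)"
  shows "P p"
proof -
  have "p = (\<Sum>m\<in>Poly_Mapping.keys p. Poly_Mapping.single m (Poly_Mapping.lookup p m))"
    by (rule poly_mapping_eqI)
      (auto simp: lookup_sum lookup_single when_def in_keys_iff sum.delta)
  moreover have "P (\<Sum>m\<in>A. Poly_Mapping.single m (Poly_Mapping.lookup p m))" if "finite A" for A
    using that by (induction A) (auto intro: assms)
  ultimately show ?thesis by (metis finite_keys)
qed

lemma Var_power: "Var i ^ n = Poly_Mapping.single (Poly_Mapping.single i n) 1"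
proof (induction n)
  case (Suc n)
  then show ?case
    by (simp add: Var_def mult_single flip: single_add)
qed simp

lemma exponent_split:
  "(m :: 3 \<Rightarrow>\<^sub>0 nat) = Poly_Mapping.single 1 (Poly_Mapping.lookup m 1) +
     Poly_Mapping.single 2 (Poly_Mapping.lookup m 2) + Poly_Mapping.single 3 (Poly_Mapping.lookup m 3)"
proof (rule poly_mapping_eqI)
  fix i :: 3
  show "Poly_Mapping.lookup m i = Poly_Mapping.lookup (Poly_Mapping.single 1 (Poly_Mapping.lookup m 1) +
     Poly_Mapping.single 2 (Poly_Mapping.lookup m 2) + Poly_Mapping.single 3 (Poly_Mapping.lookup m 3)) i"
    using exhaust_3[of i] by (auto simp: lookup_add lookup_single when_def)
qed

lemma single_eq_monomial:
  "Poly_Mapping.single m c = Const c * Var 1 ^ Poly_Mapping.lookup m 1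
     * Var 2 ^ Poly_Mapping.lookup m 2 * Var 3 ^ Poly_Mapping.lookup m 3"
  by (subst exponent_split) (simp add: Const_def Var_power mult_single)

text \<open>
  Multiplying by a single variable at a time suits statements about ideals and about the
  action by differentiation, where a product of two arbitrary polynomials is awkward.
\<close>

lemma tpoly_induct_Var [case_names Const add Var_mult]:
  assumes C: "\<And>c. P (Const c)"
    and A: "\<And>p q. P p \<Longrightarrow> P q \<Longrightarrow> P (p + q)"
    and V: "\<And>i p. P p \<Longrightarrow> P (Var i * p)"
  shows "P p"
proof (induction p rule: single_induct)
  case zero
  show ?case using C[of 0] by simp
next
  case (single m c)
  have pow: "P (Var i ^ n * p)" if "P p" for i n p
    using that by (induction n) (auto simp: mult.assoc intro: V)
  have "P (Var 1 ^ Poly_Mapping.lookup m 1 * (Var 2 ^ Poly_Mapping.lookup m 2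
      * (Var 3 ^ Poly_Mapping.lookup m 3 * Const c)))"
    by (intro pow C)
  then show ?case by (simp add: single_eq_monomial ac_simps)
qed (rule A)

lemma tpoly_induct [case_names Const Var add mult]:
  assumes "\<And>c. P (Const c)" "\<And>i. P (Var i)"
    and "\<And>p q. P p \<Longrightarrow> P q \<Longrightarrow> P (p + q)" "\<And>p q. P p \<Longrightarrow> P q \<Longrightarrow> P (p * q)"
  shows "P p"
  by (induction p rule: tpoly_induct_Var) (auto intro: assms)

definition coeff_hom :: "(complex \<Rightarrow> 'b::comm_ring_1) \<Rightarrow> bool" where
  "coeff_hom h \<longleftrightarrow> h 0 = 0 \<and> h 1 = 1 \<and> (\<forall>a b. h (a + b) = h a + h b \<and> h (a * b) = h a * h b)"

lemma coeff_hom_id: "coeff_hom (\<lambda>c. c)" and coeff_hom_Const: "coeff_hom Const"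
  by (auto simp: coeff_hom_def Const_add Const_mult)

lemma subst_poly_single:
  "coeff_hom h \<Longrightarrow> subst_poly h s (Poly_Mapping.single m c) = h c * (\<Prod>i\<in>UNIV. s i ^ Poly_Mapping.lookup m i)"
  by (auto simp: subst_poly_def coeff_hom_def)

lemma subst_poly_0 [simp]: "subst_poly h s 0 = 0" by (simp add: subst_poly_def)

lemma subst_poly_add:
  assumes "coeff_hom h"
  shows "subst_poly h s (p + q) = subst_poly h s p + subst_poly h s q"
  unfolding subst_poly_def
  by (rule setsum_keys_plus_distrib) (use assms in \<open>auto simp: coeff_hom_def algebra_simps\<close>)

lemma subst_poly_mult:
  assumes h: "coeff_hom h"
  shows "subst_poly h s (p * q) = subst_poly h s p * subst_poly h s q"
proof (induction p rule: single_induct)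
  case (single m c)
  show ?case
  proof (induction q rule: single_induct)
    case (single n d)
    show ?case
      using h by (simp add: mult_single subst_poly_single lookup_add power_add prod.distrib coeff_hom_def)
  qed (auto simp: subst_poly_add[OF h] distrib_left)
qed (auto simp: subst_poly_add[OF h] distrib_right)

lemma subst_poly_Const: "coeff_hom h \<Longrightarrow> subst_poly h s (Const c) = h c"
  by (simp add: Const_def subst_poly_single)

lemma subst_poly_Var: "coeff_hom h \<Longrightarrow> subst_poly h s (Var i) = s i"
proof -
  assume h: "coeff_hom h"
  have "(\<Prod>j\<in>UNIV. s j ^ Poly_Mapping.lookup (Poly_Mapping.single i (Suc 0)) j) = (\<Prod>j\<in>UNIV. if j = i then s j else 1)"
    by (rule prod.cong) (auto simp: lookup_single when_def)
  then show ?thesis using h by (simp add: Var_def subst_poly_single) (simp add: coeff_hom_def prod.delta)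
qed

lemma subst_poly_uminus: "coeff_hom h \<Longrightarrow> subst_poly h s (- p) = - subst_poly h s p"
  by (metis add.right_inverse add_eq_0_iff subst_poly_0 subst_poly_add)

lemma subst_poly_diff: "coeff_hom h \<Longrightarrow> subst_poly h s (p - q) = subst_poly h s p - subst_poly h s q"
  using subst_poly_add[of h s p "- q"] by (simp add: subst_poly_uminus)

lemma subst_poly_1: "coeff_hom h \<Longrightarrow> subst_poly h s 1 = 1"
  using subst_poly_Const[of h s 1] by (simp add: coeff_hom_def)

lemma subst_poly_power: "coeff_hom h \<Longrightarrow> subst_poly h s (p ^ n) = subst_poly h s p ^ n"
  by (induction n) (auto simp: subst_poly_1 subst_poly_mult)

lemma subst_poly_of_nat: "coeff_hom h \<Longrightarrow> subst_poly h s (of_nat n) = of_nat n"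
  by (induction n) (auto simp: subst_poly_1 subst_poly_add)

lemma subst_poly_numeral: "coeff_hom h \<Longrightarrow> subst_poly h s (numeral n) = numeral n"
  using subst_poly_of_nat[of h s "numeral n"] by simp

lemma subst_poly_sum: "coeff_hom h \<Longrightarrow> subst_poly h s (sum f A) = (\<Sum>i\<in>A. subst_poly h s (f i))"
  by (induction A rule: infinite_finite_induct) (auto simp: subst_poly_add)

lemmas subst_poly_hom = subst_poly_add subst_poly_mult subst_poly_Const subst_poly_Var
  subst_poly_uminus subst_poly_diff subst_poly_1 subst_poly_power subst_poly_numeral subst_poly_sum

lemma eval_at_simps [simp]:
  "eval_at 0 v = 0" "eval_at 1 v = 1" "eval_at (numeral k) v = numeral k"
  "eval_at (Const c) v = c" "eval_at (Var i) v = v $ i"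
  "eval_at (p + q) v = eval_at p v + eval_at q v"
  "eval_at (p - q) v = eval_at p v - eval_at q v"
  "eval_at (- p) v = - eval_at p v"
  "eval_at (p * q) v = eval_at p v * eval_at q v"
  "eval_at (p ^ n) v = eval_at p v ^ n"
  "eval_at (sum f A) v = (\<Sum>i\<in>A. eval_at (f i) v)"
  by (simp_all add: eval_at_def subst_poly_hom coeff_hom_id)

lemma lin_subst_simps [simp]:
  "lin_subst B 0 = 0" "lin_subst B 1 = 1" "lin_subst B (numeral k) = numeral k"
  "lin_subst B (Const c) = Const c"
  "lin_subst B (p + q) = lin_subst B p + lin_subst B q"
  "lin_subst B (p - q) = lin_subst B p - lin_subst B q"
  "lin_subst B (- p) = - lin_subst B p"
  "lin_subst B (p * q) = lin_subst B p * lin_subst B q"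
  "lin_subst B (p ^ n) = lin_subst B p ^ n"
  "lin_subst B (sum f A) = (\<Sum>i\<in>A. lin_subst B (f i))"
  by (simp_all add: lin_subst_def subst_poly_hom coeff_hom_Const)

lemma lin_subst_Var: "lin_subst B (Var i) = (\<Sum>j\<in>UNIV. Const (B $ i $ j) * Var j)"
  by (simp add: lin_subst_def subst_poly_hom coeff_hom_Const)

lemma Const_sum: "Const (sum f A) = (\<Sum>i\<in>A. Const (f i))"
  by (induction A rule: infinite_finite_induct) (auto simp: Const_add)

lemma lin_subst_lin_subst: "lin_subst B (lin_subst C p) = lin_subst (C ** B) p"
proof (induction p rule: tpoly_induct)
  case (Var i)
  have "(\<Sum>j\<in>UNIV. Const (C $ i $ j) * (\<Sum>k\<in>UNIV. Const (B $ j $ k) * Var k))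
      = (\<Sum>k\<in>UNIV. Const (\<Sum>j\<in>UNIV. C $ i $ j * B $ j $ k) * Var k)"
    unfolding Const_sum Const_mult sum_distrib_left sum_distrib_right
    by (subst sum.swap) (simp add: ac_simps)
  then show ?case by (simp add: lin_subst_Var matrix_matrix_mult_def)
qed simp_all

lemma lin_subst_mat_1: "lin_subst (mat 1) p = p"
proof (induction p rule: tpoly_induct)
  case (Var i)
  have "(\<Sum>j\<in>UNIV. Const ((mat 1 :: complex^3^3) $ i $ j) * Var j) = (\<Sum>j\<in>UNIV. if j = i then Var j else 0)"
    by (rule sum.cong) (auto simp: mat_def)
  then show ?case by (simp add: lin_subst_Var)
qed simp_all

lemma eval_at_lin_subst: "eval_at (lin_subst B p) v = eval_at p (B *v v)"
  by (induction p rule: tpoly_induct) (auto simp: lin_subst_Var matrix_vector_mult_def)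

lemma pdiff_0 [simp]: "pdiff i 0 = 0" by (simp add: pdiff_def)

lemma pdiff_single: "pdiff i (Poly_Mapping.single m c)
    = Poly_Mapping.single (m - Poly_Mapping.single i 1) (of_nat (Poly_Mapping.lookup m i) * c)"
  by (auto simp: pdiff_def)

lemma pdiff_add [simp]: "pdiff i (p + q) = pdiff i p + pdiff i q"
  unfolding pdiff_def
  by (rule setsum_keys_plus_distrib) (auto simp: algebra_simps single_add)

lemma pdiff_mult [simp]: "pdiff i (p * q) = pdiff i p * q + p * pdiff i q"
proof (induction p rule: single_induct)
  case (single m c)
  show ?case
  proof (induction q rule: single_induct)
    case (single n d)
    let ?e = "Poly_Mapping.single i (1::nat)"
    have shift: "Poly_Mapping.single (a - ?e + b) (of_nat (Poly_Mapping.lookup a i) * u)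
        = Poly_Mapping.single (a + b - ?e) (of_nat (Poly_Mapping.lookup a i) * u)"
      for a b :: "3 \<Rightarrow>\<^sub>0 nat" and u :: complex
    proof (cases "Poly_Mapping.lookup a i = 0")
      case False
      then have "a - ?e + b = a + b - ?e"
        by (intro poly_mapping_eqI) (auto simp: lookup_add lookup_minus lookup_single when_def)
      then show ?thesis by simp
    qed simp
    show ?case
      using shift[of m n "c * d"] shift[of n m "c * d"]
      by (simp add: mult_single pdiff_single lookup_add distrib_right distrib_left single_add ac_simps)
  qed (auto simp: algebra_simps)
qed (auto simp: algebra_simps)

lemma pdiff_Const [simp]: "pdiff i (Const c) = 0"
  by (simp add: Const_def pdiff_single)

lemma pdiff_Var: "pdiff i (Var j) = (if i = j then 1 else 0)"
  by (auto simp: Var_def pdiff_single lookup_single when_def)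

lemma pdiff_of_nat [simp]: "pdiff i (of_nat n) = 0"
  using pdiff_Const[of i "of_nat n"] by (simp del: pdiff_Const)

lemma pdiff_1 [simp]: "pdiff i 1 = 0"
  using pdiff_of_nat[of i 1] by (simp del: pdiff_of_nat)

lemma pdiff_numeral [simp]: "pdiff i (numeral k) = 0"
  using pdiff_of_nat[of i "numeral k"] by (simp del: pdiff_of_nat)

lemma pdiff_uminus [simp]: "pdiff i (- p) = - pdiff i p"
  by (metis add.right_inverse add_eq_0_iff pdiff_0 pdiff_add)

lemma pdiff_diff [simp]: "pdiff i (p - q) = pdiff i p - pdiff i q"
  using pdiff_add[of i p "- q"] by (simp del: pdiff_add)

lemma pdiff_sum [simp]: "pdiff i (sum f A) = (\<Sum>j\<in>A. pdiff i (f j))"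
  by (induction A rule: infinite_finite_induct) auto

lemma pdiff_commute: "pdiff i (pdiff j p) = pdiff j (pdiff i p)"
  by (induction p rule: tpoly_induct) (auto simp: pdiff_Var algebra_simps)

text \<open>
  Chain rule. Both sides satisfy the same product rule, so variables suffice.
\<close>

lemma pdiff_lin_subst:
  "pdiff i (lin_subst B p) = (\<Sum>k\<in>UNIV. Const (B $ k $ i) * lin_subst B (pdiff k p))"
proof (induction p rule: tpoly_induct)
  case (Var j)
  have "(\<Sum>k\<in>UNIV. Const (B $ j $ k) * (if i = k then 1 else 0)) = Const (B $ j $ i)"
    using exhaust_3[of i] by (auto simp: sum_3)
  moreover have "(\<Sum>k\<in>UNIV. Const (B $ k $ i) * lin_subst B (if k = j then 1 else 0)) = Const (B $ j $ i)"
    using exhaust_3[of j] by (auto simp: sum_3)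
  ultimately show ?case by (simp add: lin_subst_Var pdiff_Var)
qed (auto simp: sum.distrib algebra_simps sum_distrib_left sum_distrib_right)

lemma prod_3: "prod f (UNIV :: 3 set) = f 1 * f 2 * (f 3 :: 'a::comm_monoid_mult)"
  unfolding UNIV_3 by (simp add: ac_simps)

text \<open>
  Kronecker substitution: with \<open>N\<close> larger than all exponents, \<open>x = t, y = t ^ N, z = t ^ (N * N)\<close> sends
  distinct monomials to distinct powers of \<open>t\<close>, because the exponents become the digits of a number in
  base \<open>N\<close>. This reduces the claim to univariate polynomials over an infinite field. It lets all
  explicit identities between cubics be checked in the field of complex numbers.
\<close>

lemma eval_at_injective:
  assumes "\<And>v. eval_at p v = eval_at q v"
  shows "p = q"
proof -
  define r where "r = p - q"
  have r0: "eval_at r v = 0" for v by (simp add: r_def assms)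
  have "finite (\<Union>m\<in>Poly_Mapping.keys r. range (Poly_Mapping.lookup m))" by simp
  then obtain N where "\<forall>k\<in>(\<Union>m\<in>Poly_Mapping.keys r. range (Poly_Mapping.lookup m)). k < N"
    unfolding finite_nat_set_iff_bounded ..
  then have N: "\<And>m i. m \<in> Poly_Mapping.keys r \<Longrightarrow> Poly_Mapping.lookup m i < N" by simp
  define wt :: "(3 \<Rightarrow>\<^sub>0 nat) \<Rightarrow> nat"
    where "wt m = Poly_Mapping.lookup m 1 + N * (Poly_Mapping.lookup m 2 + N * Poly_Mapping.lookup m 3)" for m
  have wt_inj: "m = n" if "m \<in> Poly_Mapping.keys r" "n \<in> Poly_Mapping.keys r" "wt m = wt n" for m n
  proof -
    have digits: "a = c \<and> b = d" if "a + N * b = c + N * d" "a < N" "c < N" for a b c d :: nat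
    proof -
      have "a = (a + N * b) mod N" "b = (a + N * b) div N" "c = (c + N * d) mod N" "d = (c + N * d) div N"
        using that(2,3) by simp_all
      then show ?thesis using that(1) by metis
    qed
    have 1: "Poly_Mapping.lookup m 1 = Poly_Mapping.lookup n 1 \<and>
        Poly_Mapping.lookup m 2 + N * Poly_Mapping.lookup m 3 = Poly_Mapping.lookup n 2 + N * Poly_Mapping.lookup n 3"
      using that(3) unfolding wt_def by (rule digits) (rule N that)+
    have 2: "Poly_Mapping.lookup m 2 = Poly_Mapping.lookup n 2 \<and> Poly_Mapping.lookup m 3 = Poly_Mapping.lookup n 3"
      using 1[THEN conjunct2] by (rule digits) (rule N that)+
    have "Poly_Mapping.lookup m i = Poly_Mapping.lookup n i" for i
      using 1 2 exhaust_3[of i] by auto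
    then show ?thesis by (rule poly_mapping_eqI)
  qed
  define g where "g = (\<Sum>m\<in>Poly_Mapping.keys r. monom (Poly_Mapping.lookup r m) (wt m))"
  have pow: "t ^ wt m = t ^ Poly_Mapping.lookup m 1 * (t ^ N) ^ Poly_Mapping.lookup m 2
      * (t ^ (N * N)) ^ Poly_Mapping.lookup m 3" for t :: complex and m
    unfolding power_mult[symmetric] power_add[symmetric] wt_def
    by (rule arg_cong[where f = "\<lambda>n. t ^ n"]) (simp add: distrib_left)
  have "poly g t = eval_at r (vector [t, t ^ N, t ^ (N * N)])" for t
    unfolding g_def poly_sum poly_monom eval_at_def subst_poly_def pow
    by (rule sum.cong[OF refl]) (simp only: prod_3 vector_3)
  then have "\<forall>t. poly g t = 0" using r0 by simp
  then have "g = 0" by (simp add: poly_all_0_iff_0)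
  have "Poly_Mapping.lookup r m = 0" if m: "m \<in> Poly_Mapping.keys r" for m
  proof -
    have "coeff g (wt m) = (\<Sum>n\<in>Poly_Mapping.keys r. if n = m then Poly_Mapping.lookup r n else 0)"
      unfolding g_def coeff_sum
    proof (rule sum.cong[OF refl])
      fix n assume "n \<in> Poly_Mapping.keys r"
      then have "wt n = wt m \<longleftrightarrow> n = m" using wt_inj m by blast
      then show "coeff (monom (Poly_Mapping.lookup r n) (wt n)) (wt m) = (if n = m then Poly_Mapping.lookup r n else 0)"
        by simp
    qed
    then show ?thesis using \<open>g = 0\<close> m by (simp add: sum.delta)
  qed
  then have "r = 0" by (metis in_keys_iff lookup_zero poly_mapping_eqI)
  then show ?thesis by (simp add: r_def)
qed

section \<open>Homogeneous polynomials\<close>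

lemma homogeneous_0 [simp]: "homogeneous d 0" by (simp add: homogeneous_def)

lemma homogeneous_add: "homogeneous d p \<Longrightarrow> homogeneous d q \<Longrightarrow> homogeneous d (p + q)"
  unfolding homogeneous_def using keys_add[of p q] by blast

lemma homogeneous_uminus: "homogeneous d p \<Longrightarrow> homogeneous d (- p)"
  by (auto simp: homogeneous_def in_keys_iff)

lemma homogeneous_diff: "homogeneous d p \<Longrightarrow> homogeneous d q \<Longrightarrow> homogeneous d (p - q)"
  using homogeneous_add[of d p "- q"] homogeneous_uminus by simp

lemma homogeneous_single: "(\<Sum>i\<in>UNIV. Poly_Mapping.lookup m i) = d \<Longrightarrow> homogeneous d (Poly_Mapping.single m c)"
  by (auto simp: homogeneous_def)

lemma homogeneous_mult:
  assumes "homogeneous d p" "homogeneous e q"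
  shows "homogeneous (d + e) (p * q)"
  unfolding homogeneous_def
proof
  fix m assume "m \<in> Poly_Mapping.keys (p * q)"
  then obtain a b where "m = a + b" "a \<in> Poly_Mapping.keys p" "b \<in> Poly_Mapping.keys q"
    using keys_mult[of p q] by blast
  then show "(\<Sum>i\<in>UNIV. Poly_Mapping.lookup m i) = d + e"
    using assms by (simp add: homogeneous_def lookup_add sum.distrib)
qed

lemma homogeneous_Const: "homogeneous 0 (Const c)" by (simp add: Const_def homogeneous_single)
lemma homogeneous_one: "homogeneous 0 1"
  using homogeneous_Const[of 1] by simp
lemma homogeneous_Const_mult: "homogeneous d p \<Longrightarrow> homogeneous d (Const c * p)"
  using homogeneous_mult[OF homogeneous_Const] by simp

lemma homogeneous_Var: "homogeneous 1 (Var i)"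
  unfolding Var_def
proof (rule homogeneous_single)
  show "(\<Sum>j\<in>UNIV. Poly_Mapping.lookup (Poly_Mapping.single i 1) j) = (1::nat)"
    using exhaust_3[of i] by (auto simp: sum_3 lookup_single when_def)
qed

lemma homogeneous_power: "homogeneous d p \<Longrightarrow> homogeneous (n * d) (p ^ n)"
  by (induction n) (auto intro!: homogeneous_mult simp: homogeneous_one)

lemma homogeneous_sum: "(\<And>i. i \<in> A \<Longrightarrow> homogeneous d (f i)) \<Longrightarrow> homogeneous d (sum f A)"
  by (induction A rule: infinite_finite_induct) (auto intro: homogeneous_add)

lemma homogeneous_lin_subst:
  assumes "homogeneous d p"
  shows "homogeneous d (lin_subst B p)"
  unfolding lin_subst_def subst_poly_def
proof (rule homogeneous_sum)
  fix m assume "m \<in> Poly_Mapping.keys p"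
  then have d: "d = Poly_Mapping.lookup m 1 * 1 + Poly_Mapping.lookup m 2 * 1 + Poly_Mapping.lookup m 3 * 1"
    using assms by (simp add: homogeneous_def sum_3)
  have "homogeneous 1 (\<Sum>j\<in>UNIV. Const (B $ i $ j) * Var j)" for i
    by (intro homogeneous_sum homogeneous_Const_mult homogeneous_Var)
  then show "homogeneous d (Const (Poly_Mapping.lookup p m)
      * (\<Prod>i\<in>UNIV. (\<Sum>j\<in>UNIV. Const (B $ i $ j) * Var j) ^ Poly_Mapping.lookup m i))"
    unfolding d prod_3 by (intro homogeneous_Const_mult homogeneous_mult homogeneous_power)
qed

lemma homogeneous_pdiff:
  assumes "homogeneous (Suc d) p"
  shows "homogeneous d (pdiff i p)"
  unfolding pdiff_def
proof (rule homogeneous_sum)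
  fix m assume "m \<in> Poly_Mapping.keys p"
  then have m: "Poly_Mapping.lookup m 1 + Poly_Mapping.lookup m 2 + Poly_Mapping.lookup m 3 = Suc d"
    using assms by (simp add: homogeneous_def sum_3)
  show "homogeneous d (Poly_Mapping.single (m - Poly_Mapping.single i 1)
          (of_nat (Poly_Mapping.lookup m i) * Poly_Mapping.lookup p m))"
  proof (cases "Poly_Mapping.lookup m i = 0")
    case False
    then show ?thesis
      using m exhaust_3[of i]
      by (intro homogeneous_single) (auto simp: sum_3 lookup_minus lookup_single when_def)
  qed simp
qed

section \<open>Projective equivalence\<close>

lemma lin_subst_inverse:
  "B ** A = mat 1 \<Longrightarrow> lin_subst A (lin_subst B p) = p"
  by (simp add: lin_subst_lin_subst lin_subst_mat_1)

lemma Const_cancel: "c \<noteq> 0 \<Longrightarrow> Const (inverse c) * (Const c * p) = p"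
  by (simp flip: mult.assoc Const_mult)

lemma proj_equivI:
  assumes "p \<noteq> 0" "homogeneous d p" "invertible B" "c \<noteq> 0" "q = Const c * lin_subst B p"
  shows "proj_equiv p q"
proof -
  obtain A where "B ** A = mat 1" using assms(3) unfolding invertible_def by blast
  then have "lin_subst A (Const (inverse c) * q) = p"
    using assms(4) unfolding assms(5) Const_cancel[OF assms(4)] by (simp add: lin_subst_inverse)
  then have "q \<noteq> 0" using assms(1) by auto
  then show ?thesis
    unfolding proj_equiv_def using assms homogeneous_Const_mult homogeneous_lin_subst by blast
qed

lemma proj_equiv_evalI:
  assumes "p \<noteq> 0" "homogeneous d p" "invertible B" "c \<noteq> 0"
    and "\<And>v. eval_at q v = c * eval_at p (B *v v)"
  shows "proj_equiv p q"
  using assms(1-4) by (rule proj_equivI) (rule eval_at_injective, simp add: assms(5) eval_at_lin_subst)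

lemma proj_equivE:
  assumes "proj_equiv p q"
  obtains B A c where "B ** A = mat 1" "A ** B = mat 1" "c \<noteq> 0" "q = Const c * lin_subst B p"
    "p = Const (inverse c) * lin_subst A q"
proof -
  obtain B c where B: "invertible B" and c: "c \<noteq> 0" "q = Const c * lin_subst B p"
    using assms unfolding proj_equiv_def by blast
  obtain A where A: "B ** A = mat 1" "A ** B = mat 1" using B unfolding invertible_def by blast
  have "p = Const (inverse c) * lin_subst A q"
    using c A by (simp add: lin_subst_inverse Const_cancel)
  then show ?thesis using that A c by blast
qed

lemma proj_equiv_refl: "p \<noteq> 0 \<Longrightarrow> homogeneous d p \<Longrightarrow> proj_equiv p p"
  by (rule proj_equivI[where B = "mat 1" and c = 1]) (auto simp: lin_subst_mat_1 invertible_def)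

lemma proj_equiv_sym: 
  assumes "proj_equiv p q" shows "proj_equiv q p"
proof -
  obtain B A c where *: "B ** A = mat 1" "A ** B = mat 1" "c \<noteq> 0" "p = Const (inverse c) * lin_subst A q"
    using assms by (rule proj_equivE)
  obtain d where "homogeneous d q" "q \<noteq> 0" using assms unfolding proj_equiv_def by blast
  then show ?thesis
    using * by (intro proj_equivI[where B = A and c = "inverse c"]) (auto simp: invertible_def)
qed

lemma proj_equiv_trans:
  assumes "proj_equiv p q" "proj_equiv q r" shows "proj_equiv p r"
proof -
  obtain B c where 1: "invertible B" "c \<noteq> 0" "q = Const c * lin_subst B p"
    using assms(1) unfolding proj_equiv_def by blast
  obtain B' c' where 2: "invertible B'" "c' \<noteq> 0" "r = Const c' * lin_subst B' q"
    using assms(2) unfolding proj_equiv_def by blast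
  obtain d where "homogeneous d p" "p \<noteq> 0" using assms unfolding proj_equiv_def by blast
  moreover have "r = Const (c' * c) * lin_subst (B ** B') p"
    using 1 2 by (simp add: lin_subst_lin_subst Const_mult mult.assoc)
  ultimately show ?thesis
    using 1 2 invertible_mult by (intro proj_equivI[where B = "B ** B'" and c = "c' * c"]) auto
qed

lemma proj_equiv_Const_mult: "p \<noteq> 0 \<Longrightarrow> homogeneous d p \<Longrightarrow> c \<noteq> 0 \<Longrightarrow> proj_equiv p (Const c * p)"
  by (rule proj_equivI[where B = "mat 1" and c = c]) (auto simp: lin_subst_mat_1 invertible_def)

lemma matrix_inverse_vector:
  assumes "B ** A = (mat 1 :: complex^3^3)"
  shows "B *v (A *v v) = v"
  using assms by (simp add: matrix_vector_mul_assoc)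

text \<open>
  By the chain rule the gradient of the new cubic at \<open>v\<close> is the transposed matrix applied to the
  gradient of \<open>f\<close> at \<open>B v\<close>, and an invertible matrix does not kill a nonzero vector.
\<close>

lemma smooth_cubic_proj_equiv:
  assumes f: "smooth_cubic f" and "proj_equiv f f'"
  shows "smooth_cubic f'"
proof -
  obtain B A c where BA: "B ** A = mat 1" "A ** B = mat 1" and c: "c \<noteq> 0" and f': "f' = Const c * lin_subst B f"
    using assms(2) by (rule proj_equivE)
  show ?thesis
    unfolding smooth_cubic_def
  proof (intro conjI allI impI)
    show "f' \<noteq> 0" using assms(2) by (simp add: proj_equiv_def)
    show "homogeneous 3 f'"
      using f unfolding f' smooth_cubic_def by (auto intro: homogeneous_Const_mult homogeneous_lin_subst)
    fix v assume v: "v \<noteq> 0 \<and> eval_at f' v = 0"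
    have "B *v v \<noteq> 0" using v matrix_inverse_vector[OF BA(2), of v] by auto
    moreover have "eval_at f (B *v v) = 0" using v c by (simp add: f' eval_at_lin_subst)
    ultimately obtain k where k: "eval_at (pdiff k f) (B *v v) \<noteq> 0"
      using f unfolding smooth_cubic_def by blast
    define w where "w = (\<chi> i. eval_at (pdiff i f) (B *v v))"
    show "\<exists>i. eval_at (pdiff i f') v \<noteq> 0"
    proof (rule ccontr)
      assume "\<not> ?thesis"
      then have "(\<Sum>k\<in>UNIV. B $ k $ i * w $ k) = 0" for i
        using c by (auto simp: f' pdiff_lin_subst eval_at_lin_subst w_def)
      then have "w v* B = 0"
        by (simp add: vec_eq_iff vector_matrix_mult_def mult.commute)
      then have "w v* (B ** A) = 0" by (metis vector_matrix_mul_assoc vector_matrix_mult_0)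
      then show False using k BA(1) by (simp add: w_def vec_eq_iff)
    qed
  qed
qed

section \<open>The Hessian as a covariant\<close>

lemma Hess_Const_mult: "Hess (Const c * f) = Const (c ^ 3) * Hess f"
  by (simp add: Hess_def det_3 power3_eq_cube Const_mult algebra_simps)

text \<open>
  The chain rule turns the matrix \<open>H\<close> of second derivatives into \<open>C\<^sup>T H C\<close>, where \<open>C\<close> is the
  matrix of the substitution with constant polynomials as entries.
\<close>

lemma Hess_lin_subst: "Hess (lin_subst B f) = Const (det B ^ 2) * lin_subst B (Hess f)"
proof -
  define C where "C = (\<chi> i j. Const (B $ i $ j))"
  define M where "M = (\<chi> i j. lin_subst B (pdiff i (pdiff j f)))"
  have "(\<chi> i j. pdiff i (pdiff j (lin_subst B f))) = transpose C ** M ** C"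
    by (simp add: vec_eq_iff matrix_matrix_mult_def transpose_def C_def M_def pdiff_lin_subst
        sum_distrib_left sum_distrib_right ac_simps)
  then have "Hess (lin_subst B f) = det C * det M * det C"
    by (simp add: Hess_def det_mul)
  moreover have "det C = Const (det B)"
    by (simp add: C_def det_3 Const_add Const_mult Const_diff)
  moreover have "det M = lin_subst B (Hess f)"
    by (simp add: M_def Hess_def det_3)
  ultimately show ?thesis by (simp add: power2_eq_square Const_mult ac_simps)
qed

section \<open>The Macaulay polynomial as a contravariant\<close>

lemma diff_act_0 [simp]: "diff_act 0 g = 0" by (simp add: diff_act_def)

lemma diff_act_add [simp]: "diff_act (p + q) g = diff_act p g + diff_act q g"
  unfolding diff_act_def
  by (rule setsum_keys_plus_distrib) (auto simp: Const_add distrib_right)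

lemma pdiff_funpow_commute: "pdiff i ((pdiff j ^^ n) g) = (pdiff j ^^ n) (pdiff i g)"
  by (induction n) (simp_all add: pdiff_commute[of i j])

lemma diff_act_Const [simp]: "diff_act (Const c) g = Const c * g"
  by (auto simp: diff_act_def Const_def)

lemma diff_act_1 [simp]: "diff_act 1 g = g"
  using diff_act_Const[of 1 g] by (simp del: diff_act_Const)

lemma diff_act_numeral [simp]: "diff_act (numeral k) g = numeral k * g"
  using diff_act_Const[of "numeral k" g] by (simp del: diff_act_Const)

lemma diff_act_Var_mult: "diff_act (Var i * p) g = pdiff i (diff_act p g)"
proof (induction p rule: single_induct)
  case (single m c)
  have "diff_act (Poly_Mapping.single n c) g = Const c *
        (pdiff 1 ^^ Poly_Mapping.lookup n 1)
          ((pdiff 2 ^^ Poly_Mapping.lookup n 2)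
            ((pdiff 3 ^^ Poly_Mapping.lookup n 3) g))" for n
    by (auto simp: diff_act_def)
  then show ?case
    using exhaust_3[of i]
    by (auto simp: Var_def mult_single lookup_add lookup_single when_def pdiff_funpow_commute funpow_swap1)
qed (auto simp: distrib_left)

lemma diff_act_Var [simp]: "diff_act (Var i) g = pdiff i g"
  using diff_act_Var_mult[of i 1 g] diff_act_Const[of 1 g] by simp

lemma diff_act_Const_mult: "diff_act (Const c * p) g = Const c * diff_act p g"
proof (induction p rule: tpoly_induct_Var)
  case (Const d)
  have "diff_act (Const c * Const d) g = Const (c * d) * g" by (simp only: diff_act_Const flip: Const_mult)
  then show ?case by (simp only: diff_act_Const Const_mult mult.assoc)
next
  case (Var_mult i p)
  have "diff_act (Const c * (Var i * p)) g = diff_act (Var i * (Const c * p)) g"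
    by (simp only: mult.left_commute)
  also have "\<dots> = Const c * diff_act (Var i * p) g"
    by (simp add: diff_act_Var_mult Var_mult)
  finally show ?case .
qed (auto simp: distrib_left)

lemma diff_act_mult: "diff_act (p * q) g = diff_act p (diff_act q g)"
  by (induction p rule: tpoly_induct_Var)
    (auto simp: distrib_right diff_act_Const_mult diff_act_Var_mult mult.assoc)

lemma diff_act_zero_right [simp]: "diff_act p 0 = 0"
  by (induction p rule: tpoly_induct_Var) (auto simp: diff_act_Var_mult)

lemma diff_act_uminus [simp]: "diff_act (- p) g = - diff_act p g"
  using diff_act_Const_mult[of "-1" p g] by (simp add: Const_uminus)

lemma diff_act_diff [simp]: "diff_act (p - q) g = diff_act p g - diff_act q g"
  using diff_act_add[of p "- q" g] by (simp del: diff_act_add)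

lemma diff_act_sum: "diff_act (sum f A) g = (\<Sum>i\<in>A. diff_act (f i) g)"
  by (induction A rule: infinite_finite_induct) auto

text \<open>
  Differential operators transform contragrediently to polynomials: the chain rule pairs the
  rows of \<open>B\<close> with the rows of \<open>C\<close>, and the hypothesis makes them dual bases.
\<close>

lemma diff_act_lin_subst:
  assumes BC: "B ** transpose C = mat 1"
  shows "diff_act (lin_subst B p) (lin_subst C g) = lin_subst C (diff_act p g)"
proof (induction p rule: tpoly_induct_Var)
  case (Var_mult i p)
  define h where "h = diff_act p g"
  have "diff_act (lin_subst B (Var i * p)) (lin_subst C g)
      = (\<Sum>j\<in>UNIV. Const (B $ i $ j) * pdiff j (lin_subst C h))"
    by (simp add: lin_subst_Var sum_distrib_right mult.assoc diff_act_sum diff_act_Const_mult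
        diff_act_Var_mult Var_mult h_def)
  also have "\<dots> = (\<Sum>k\<in>UNIV. Const (\<Sum>j\<in>UNIV. B $ i $ j * C $ k $ j) * lin_subst C (pdiff k h))"
    unfolding pdiff_lin_subst Const_sum Const_mult sum_distrib_left sum_distrib_right
    by (subst sum.swap) (simp add: ac_simps)
  also have "\<dots> = (\<Sum>k\<in>UNIV. Const ((mat 1 :: complex^3^3) $ i $ k) * lin_subst C (pdiff k h))"
    unfolding BC[symmetric] by (simp add: matrix_matrix_mult_def transpose_def)
  also have "(\<Sum>k\<in>UNIV. Const ((mat 1 :: complex^3^3) $ i $ k) * lin_subst C (pdiff k h))
      = (\<Sum>k\<in>UNIV. if k = i then lin_subst C (pdiff k h) else 0)"
    by (rule sum.cong) (auto simp: mat_def)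
  finally show ?case by (simp add: diff_act_Var_mult h_def)
qed simp_all

lemma jacobian_ideal_pdiff: "pdiff i f \<in> jacobian_ideal f"
proof -
  have "(\<Sum>k\<in>UNIV. (if k = i then 1 else 0) * pdiff k f) = pdiff i f"
    using exhaust_3[of i] by (elim disjE) (simp_all add: sum_3)
  then show ?thesis
    unfolding jacobian_ideal_def by (intro CollectI exI[of _ "\<lambda>k. if k = i then 1 else 0"]) simp
qed

lemma jacobian_ideal_add:
  assumes "p \<in> jacobian_ideal f" "q \<in> jacobian_ideal f"
  shows "p + q \<in> jacobian_ideal f"
proof -
  obtain h k where "p = (\<Sum>i\<in>UNIV. h i * pdiff i f)" "q = (\<Sum>i\<in>UNIV. k i * pdiff i f)"
    using assms unfolding jacobian_ideal_def by blast
  then have "p + q = (\<Sum>i\<in>UNIV. (h i + k i) * pdiff i f)" by (simp add: sum.distrib distrib_right)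
  then show ?thesis unfolding jacobian_ideal_def by (intro CollectI exI[of _ "\<lambda>i. h i + k i"]) simp
qed

lemma jacobian_ideal_mult:
  assumes "p \<in> jacobian_ideal f"
  shows "q * p \<in> jacobian_ideal f"
proof -
  obtain h where "p = (\<Sum>i\<in>UNIV. h i * pdiff i f)"
    using assms unfolding jacobian_ideal_def by blast
  then have "q * p = (\<Sum>i\<in>UNIV. (q * h i) * pdiff i f)" by (simp add: sum_distrib_left mult.assoc)
  then show ?thesis unfolding jacobian_ideal_def by (intro CollectI exI[of _ "\<lambda>i. q * h i"]) simp
qed

lemma jacobian_ideal_0: "0 \<in> jacobian_ideal f"
  using jacobian_ideal_mult[OF jacobian_ideal_pdiff, of 0 1 f] by simp

lemma jacobian_ideal_cancel:
  "Const c * p \<in> jacobian_ideal f \<Longrightarrow> c \<noteq> 0 \<Longrightarrow> p \<in> jacobian_ideal f"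
  using jacobian_ideal_mult[of "Const c * p" f "Const (inverse c)"] by (simp add: Const_cancel)

lemma jacobian_ideal_sum:
  "(\<And>i. i \<in> A \<Longrightarrow> g i \<in> jacobian_ideal f) \<Longrightarrow> sum g A \<in> jacobian_ideal f"
  by (induction A rule: infinite_finite_induct) (auto simp: jacobian_ideal_0 jacobian_ideal_add)

lemma jacobian_ideal_lin_subst:
  assumes "p \<in> jacobian_ideal (Const c * lin_subst B f)" "B ** A = mat 1"
  shows "lin_subst A p \<in> jacobian_ideal f"
proof -
  obtain h where "p = (\<Sum>i\<in>UNIV. h i * pdiff i (Const c * lin_subst B f))"
    using assms(1) unfolding jacobian_ideal_def by blast
  then have "lin_subst A p = (\<Sum>i\<in>UNIV. \<Sum>k\<in>UNIV. (lin_subst A (h i) * Const c * Const (B $ k $ i)) * pdiff k f)"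
    by (simp add: pdiff_lin_subst sum_distrib_left lin_subst_inverse[OF assms(2)] ac_simps)
  then show ?thesis by (auto intro!: jacobian_ideal_sum jacobian_ideal_mult jacobian_ideal_pdiff)
qed

text \<open>
  The Jacobian ideal moves along with \<open>f\<close>, and annihilators move along with the dual
  substitution; hence a Macaulay polynomial of \<open>f\<close> gives one of each transformed cubic.
\<close>

lemma jacobian_ideal_eq_perp_lin_subst:
  assumes "jacobian_ideal f = perp g" "B ** A = mat 1" "A ** B = mat 1" "c \<noteq> 0"
  shows "jacobian_ideal (Const c * lin_subst B f) = perp (lin_subst (transpose A) g)"
proof (rule set_eqI)
  fix p
  have f: "f = Const (inverse c) * lin_subst A (Const c * lin_subst B f)"
    using assms by (simp add: lin_subst_inverse Const_cancel)
  have BA: "lin_subst B (lin_subst A p) = p" using assms(3) by (rule lin_subst_inverse)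
  have AB': "lin_subst (transpose B) (lin_subst (transpose A) q) = q" for q
    using assms(2) by (intro lin_subst_inverse) (simp flip: matrix_transpose_mul)
  have "p \<in> jacobian_ideal (Const c * lin_subst B f) \<longleftrightarrow> lin_subst A p \<in> jacobian_ideal f"
  proof
    assume "lin_subst A p \<in> jacobian_ideal f"
    then have "lin_subst B (lin_subst A p) \<in> jacobian_ideal (Const c * lin_subst B f)"
      using jacobian_ideal_lin_subst[OF _ assms(3)] f by metis
    then show "p \<in> jacobian_ideal (Const c * lin_subst B f)" by (simp only: BA)
  qed (rule jacobian_ideal_lin_subst[OF _ assms(2)])
  also have "\<dots> \<longleftrightarrow> diff_act (lin_subst A p) g = 0" by (simp add: assms(1) perp_def)
  also have "\<dots> \<longleftrightarrow> lin_subst (transpose A) (diff_act (lin_subst A p) g) = 0"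
    using AB'[of "diff_act (lin_subst A p) g"] by auto
  also have "lin_subst (transpose A) (diff_act (lin_subst A p) g) = diff_act p (lin_subst (transpose A) g)"
    using diff_act_lin_subst[of B "transpose A" "lin_subst A p" g] assms(2) by (simp add: BA)
  finally show "p \<in> jacobian_ideal (Const c * lin_subst B f) \<longleftrightarrow> p \<in> perp (lin_subst (transpose A) g)"
    by (simp add: perp_def)
qed

section \<open>Euler identity and the coefficients of a cubic form\<close>

lemma Euler_single: "(\<Sum>i\<in>UNIV. Var i * pdiff i (Poly_Mapping.single m c))
   = of_nat (\<Sum>i\<in>UNIV. Poly_Mapping.lookup m i) * Poly_Mapping.single m c"
proof -
  have "Var i * pdiff i (Poly_Mapping.single m c) = of_nat (Poly_Mapping.lookup m i) * Poly_Mapping.single m c" for i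
  proof (cases "Poly_Mapping.lookup m i = 0")
    case False
    then have "Poly_Mapping.single i (Suc 0) + (m - Poly_Mapping.single i (Suc 0)) = m"
      by (intro poly_mapping_eqI) (auto simp: lookup_add lookup_minus lookup_single when_def)
    then show ?thesis by (simp add: Var_def pdiff_single mult_single flip: single_of_nat)
  qed (simp add: pdiff_single)
  then show ?thesis by (simp add: sum_distrib_right)
qed

lemma Euler_identity:
  assumes "homogeneous d p"
  shows "(\<Sum>i\<in>UNIV. Var i * pdiff i p) = of_nat d * p"
proof -
  have p: "p = (\<Sum>m\<in>Poly_Mapping.keys p. Poly_Mapping.single m (Poly_Mapping.lookup p m))"
    by (rule poly_mapping_eqI)
      (auto simp: lookup_sum lookup_single when_def in_keys_iff sum.delta)
  have "(\<Sum>i\<in>UNIV. Var i * pdiff i p) = (\<Sum>m\<in>Poly_Mapping.keys p. \<Sum>i\<in>UNIV. Var i * pdiff i (Poly_Mapping.single m (Poly_Mapping.lookup p m)))"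
    by (subst (1) p) (simp add: sum_distrib_left sum.swap[of _ "Poly_Mapping.keys p"])
  also have "\<dots> = (\<Sum>m\<in>Poly_Mapping.keys p. of_nat d * Poly_Mapping.single m (Poly_Mapping.lookup p m))"
    using assms by (intro sum.cong) (simp_all only: Euler_single homogeneous_def)
  also have "\<dots> = of_nat d * p" by (simp flip: sum_distrib_left p)
  finally show ?thesis .
qed

lemma homogeneous_0_Const:
  assumes "homogeneous 0 p" shows "p = Const (Poly_Mapping.lookup p 0)"
proof -
  have "Poly_Mapping.lookup p m = Poly_Mapping.lookup (Const (Poly_Mapping.lookup p 0)) m" for m
  proof (cases "m = 0")
    case False
    then have "\<exists>i. Poly_Mapping.lookup m i \<noteq> 0" by (metis lookup_zero poly_mapping_eqI)
    then have "m \<notin> Poly_Mapping.keys p" using assms by (auto simp: homogeneous_def)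
    then show ?thesis using False by (simp add: Const_def lookup_single in_keys_iff)
  qed (simp add: Const_def)
  then show ?thesis by (rule poly_mapping_eqI)
qed

text \<open>
  Three applications of the Euler identity express \<open>6 p\<close> through its third derivatives, which
  are constants.
\<close>

lemma homogeneous_3_expand:
  assumes "homogeneous 3 p"
  obtains a1 a2 a3 a4 a5 a6 a7 a8 a9 a10 where
   "p = Const a1 * Var 1 ^ 3 + Const a2 * Var 2 ^ 3 + Const a3 * Var 3 ^ 3
      + Const a4 * Var 1 ^ 2 * Var 2 + Const a5 * Var 1 ^ 2 * Var 3
      + Const a6 * Var 2 ^ 2 * Var 1 + Const a7 * Var 2 ^ 2 * Var 3
      + Const a8 * Var 3 ^ 2 * Var 1 + Const a9 * Var 3 ^ 2 * Var 2
      + Const a10 * Var 1 * Var 2 * Var 3"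
proof -
  have h2: "homogeneous 2 (pdiff i p)" for i using homogeneous_pdiff[of 2 p i] assms by simp
  have h1: "homogeneous 1 (pdiff j (pdiff i p))" for i j using homogeneous_pdiff[of 1 "pdiff i p" j] h2 by (simp add: numeral_2_eq_2)
  have h0: "homogeneous 0 (pdiff k (pdiff j (pdiff i p)))" for i j k
    using homogeneous_pdiff[of 0 "pdiff j (pdiff i p)" k] h1 by simp
  define c where "c i j k = Poly_Mapping.lookup (pdiff k (pdiff j (pdiff i p))) 0" for i j k
  have c: "pdiff k (pdiff j (pdiff i p)) = Const (c i j k)" for i j k
    unfolding c_def by (rule homogeneous_0_Const[OF h0])
  have e1: "pdiff j (pdiff i p) = (\<Sum>k\<in>UNIV. Var k * Const (c i j k))" for i j
    using Euler_identity[OF h1, of j i] by (simp add: c)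
  have e2: "2 * pdiff i p = (\<Sum>j\<in>UNIV. Var j * (\<Sum>k\<in>UNIV. Var k * Const (c i j k)))" for i
    using Euler_identity[OF h2, of i] by (simp add: e1)
  have e3: "3 * p = (\<Sum>i\<in>UNIV. Var i * pdiff i p)"
    using Euler_identity[OF assms] by simp
  have "6 * p = 2 * (3 * p)" by simp
  also have "\<dots> = (\<Sum>i\<in>UNIV. Var i * (2 * pdiff i p))"
    unfolding e3 by (simp only: sum_distrib_left ac_simps)
  finally have e: "6 * p = (\<Sum>i\<in>UNIV. Var i * (\<Sum>j\<in>UNIV. Var j * (\<Sum>k\<in>UNIV. Var k * Const (c i j k))))"
    by (simp only: e2)
  have ev: "6 * eval_at p v = v $ 1 * (v $ 1 * (v $ 1 * c 1 1 1 + v $ 2 * c 1 1 2 + v $ 3 * c 1 1 3)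
      + v $ 2 * (v $ 1 * c 1 2 1 + v $ 2 * c 1 2 2 + v $ 3 * c 1 2 3)
      + v $ 3 * (v $ 1 * c 1 3 1 + v $ 2 * c 1 3 2 + v $ 3 * c 1 3 3))
      + v $ 2 * (v $ 1 * (v $ 1 * c 2 1 1 + v $ 2 * c 2 1 2 + v $ 3 * c 2 1 3)
      + v $ 2 * (v $ 1 * c 2 2 1 + v $ 2 * c 2 2 2 + v $ 3 * c 2 2 3)
      + v $ 3 * (v $ 1 * c 2 3 1 + v $ 2 * c 2 3 2 + v $ 3 * c 2 3 3))
      + v $ 3 * (v $ 1 * (v $ 1 * c 3 1 1 + v $ 2 * c 3 1 2 + v $ 3 * c 3 1 3)
      + v $ 2 * (v $ 1 * c 3 2 1 + v $ 2 * c 3 2 2 + v $ 3 * c 3 2 3)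
      + v $ 3 * (v $ 1 * c 3 3 1 + v $ 2 * c 3 3 2 + v $ 3 * c 3 3 3))" for v
    using arg_cong[OF e, of "\<lambda>q. eval_at q v"] by (simp only: eval_at_simps sum_3)
  show ?thesis
  proof (rule that[of "c 1 1 1 / 6" "c 2 2 2 / 6" "c 3 3 3 / 6"
      "(c 1 1 2 + c 1 2 1 + c 2 1 1) / 6" "(c 1 1 3 + c 1 3 1 + c 3 1 1) / 6"
      "(c 2 2 1 + c 2 1 2 + c 1 2 2) / 6" "(c 2 2 3 + c 2 3 2 + c 3 2 2) / 6"
      "(c 3 3 1 + c 3 1 3 + c 1 3 3) / 6" "(c 3 3 2 + c 3 2 3 + c 2 3 3) / 6"
      "(c 1 2 3 + c 2 3 1 + c 3 1 2 + c 1 3 2 + c 3 2 1 + c 2 1 3) / 6"], rule eval_at_injective, goal_cases)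
    case (1 v)
    have "eval_at p v = (6 * eval_at p v) / 6" by simp
    then show ?case
      unfolding eval_at_simps ev
      by (simp add: add_divide_distrib power2_eq_square power3_eq_cube algebra_simps)
  qed
qed

section \<open>The Hesse pencil\<close>

definition pencil :: "complex \<Rightarrow> complex \<Rightarrow> tpoly" where
  "pencil s t = Const s * (Var 1 ^ 3 + Var 2 ^ 3 + Var 3 ^ 3) + Const t * (Var 1 * Var 2 * Var 3)"

lemma pdiff_Var_eval [simp]:
  "pdiff 1 (Var 1) = 1" "pdiff 1 (Var 2) = 0" "pdiff 1 (Var 3) = 0"
  "pdiff 2 (Var 1) = 0" "pdiff 2 (Var 2) = 1" "pdiff 2 (Var 3) = 0"
  "pdiff 3 (Var 1) = 0" "pdiff 3 (Var 2) = 0" "pdiff 3 (Var 3) = 1"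
  by (simp_all add: pdiff_Var)

lemma pdiff_power2 [simp]: "pdiff i (p ^ 2) = 2 * p * pdiff i p"
  by (simp add: power2_eq_square algebra_simps)

lemma pdiff_power3 [simp]: "pdiff i (p ^ 3) = 3 * p ^ 2 * pdiff i p"
  by (simp add: power2_eq_square power3_eq_cube algebra_simps)

lemma hesse_cubic_eq_pencil: "hesse_cubic a = pencil 1 (- 3 * a)"
  by (simp add: hesse_cubic_def pencil_def Const_uminus mult.assoc)

lemma Const_mult_pencil: "Const c * pencil s t = pencil (c * s) (c * t)"
  by (simp add: pencil_def Const_mult algebra_simps)

lemma pencil_add: "pencil s t + pencil s' t' = pencil (s + s') (t + t')"
  by (simp add: pencil_def Const_add algebra_simps)

lemma homogeneous_pencil: "homogeneous 3 (pencil s t)"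
proof -
  have "homogeneous (3 * 1) (Var i ^ 3)" for i by (rule homogeneous_power[OF homogeneous_Var])
  moreover have "homogeneous (1 + 1 + 1) (Var 1 * Var 2 * Var 3)"
    by (intro homogeneous_mult homogeneous_Var)
  ultimately show ?thesis
    unfolding pencil_def by (intro homogeneous_add homogeneous_Const_mult) (simp_all add: numeral_3_eq_3)
qed

lemma eval_at_pencil: "eval_at (pencil s t) v = s * (v $ 1 ^ 3 + v $ 2 ^ 3 + v $ 3 ^ 3) + t * (v $ 1 * v $ 2 * v $ 3)"
  by (simp add: pencil_def)

lemma pencil_inject: "pencil s t = pencil s' t' \<longleftrightarrow> s = s' \<and> t = t'"
proof
  assume eq: "pencil s t = pencil s' t'"
  have "s = s'"
    using arg_cong[OF eq, of "\<lambda>p. eval_at p (vector [1, 0, 0])"] by (simp add: eval_at_pencil)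
  moreover have "s * 3 + t = s' * 3 + t'"
    using arg_cong[OF eq, of "\<lambda>p. eval_at p (vector [1, 1, 1])"] by (simp add: eval_at_pencil)
  ultimately show "s = s' \<and> t = t'" by simp
qed simp

lemma pencil_eq_0_iff: "pencil s t = 0 \<longleftrightarrow> s = 0 \<and> t = 0"
  using pencil_inject[of s t 0 0] by (simp add: pencil_def[of 0 0])

text \<open>
  The pencil is closed under the Hessian, which acts on it by the pair of binary cubic forms given
  here. This self-map is what later makes \<open>j\<close> a projective invariant.
\<close>

lemma Hess_pencil: "Hess (pencil s t) = pencil (- 6 * s * t ^ 2) (216 * s ^ 3 + 2 * t ^ 3)"
proof (rule eval_at_injective)
  fix v
  show "eval_at (Hess (pencil s t)) v = eval_at (pencil (- 6 * s * t ^ 2) (216 * s ^ 3 + 2 * t ^ 3)) v"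
    by (simp add: Hess_def det_3 pencil_def) algebra
qed

text \<open>
  At a singular point \<open>x\<^sup>2 = ayz\<close>, \<open>y\<^sup>2 = axz\<close>, \<open>z\<^sup>2 = axy\<close>; the product of these equations is
  \<open>(1 - a\<^sup>3)(xyz)\<^sup>2 = 0\<close>, so one coordinate vanishes and then all do.
\<close>

lemma smooth_hesse_cubic:
  assumes "a ^ 3 \<noteq> 1"
  shows "smooth_cubic (hesse_cubic a)"
  unfolding smooth_cubic_def
proof (intro conjI allI impI)
  show "hesse_cubic a \<noteq> 0" "homogeneous 3 (hesse_cubic a)"
    by (simp_all add: hesse_cubic_eq_pencil pencil_eq_0_iff homogeneous_pencil)
  fix v :: "complex ^ 3" assume v: "v \<noteq> 0 \<and> eval_at (hesse_cubic a) v = 0"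
  show "\<exists>i. eval_at (pdiff i (hesse_cubic a)) v \<noteq> 0"
  proof (rule ccontr)
    assume "\<not> ?thesis"
    then have "eval_at (pdiff i (hesse_cubic a)) v = 0" for i by blast
    from this[of 1] this[of 2] this[of 3]
    have e: "v $ 1 ^ 2 = a * v $ 2 * v $ 3" "v $ 2 ^ 2 = a * v $ 1 * v $ 3" "v $ 3 ^ 2 = a * v $ 1 * v $ 2"
      by (simp_all add: hesse_cubic_eq_pencil pencil_def)
    have "(1 - a ^ 3) * (v $ 1 * v $ 2 * v $ 3) ^ 2 = 0" using e by algebra
    then have "v $ 1 = 0 \<or> v $ 2 = 0 \<or> v $ 3 = 0" using assms by auto
    then have "v $ 1 = 0 \<and> v $ 2 = 0 \<and> v $ 3 = 0" using e by auto
    then have "v = 0" by (simp add: vec_eq_iff forall_3)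
    then show False using v by simp
  qed
qed

text \<open>
  Modulo the relations, \<open>x\<^sup>2y = a y\<^sup>2z = a\<^sup>2 xz\<^sup>2 = a\<^sup>3 x\<^sup>2y\<close>, and \<open>1 - a\<^sup>3\<close> is invertible.
\<close>

lemma mixed_cube_in_jacobian_ideal:
  assumes "x * x - Const a * (y * z) \<in> jacobian_ideal f" "y * y - Const a * (x * z) \<in> jacobian_ideal f"
    "z * z - Const a * (x * y) \<in> jacobian_ideal f" "a ^ 3 \<noteq> 1"
  shows "x * x * y \<in> jacobian_ideal f"
proof -
  have "Const (1 - a ^ 3) * (x * x * y) = y * (x * x - Const a * (y * z))
      + Const a * z * (y * y - Const a * (x * z)) + Const a * Const a * x * (z * z - Const a * (x * y))"
    by (simp add: Const_diff Const_mult power3_eq_cube algebra_simps)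
  also have "\<dots> \<in> jacobian_ideal f"
    by (intro jacobian_ideal_add jacobian_ideal_mult assms)
  finally show ?thesis by (rule jacobian_ideal_cancel) (use assms(4) in auto)
qed

lemma jacobian_ideal_hesse_relations:
  defines "X \<equiv> Var 1" and "Y \<equiv> Var 2" and "Z \<equiv> Var 3"
  shows "X * X - Const a * (Y * Z) \<in> jacobian_ideal (hesse_cubic a)"
    "Y * Y - Const a * (X * Z) \<in> jacobian_ideal (hesse_cubic a)"
    "Z * Z - Const a * (X * Y) \<in> jacobian_ideal (hesse_cubic a)"
proof -
  have "pdiff 1 (hesse_cubic a) = Const 3 * (X * X - Const a * (Y * Z))"
    "pdiff 2 (hesse_cubic a) = Const 3 * (Y * Y - Const a * (X * Z))"
    "pdiff 3 (hesse_cubic a) = Const 3 * (Z * Z - Const a * (X * Y))"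
    by (simp_all add: hesse_cubic_def X_def Y_def Z_def Const_mult power2_eq_square algebra_simps)
  then show "X * X - Const a * (Y * Z) \<in> jacobian_ideal (hesse_cubic a)"
    "Y * Y - Const a * (X * Z) \<in> jacobian_ideal (hesse_cubic a)"
    "Z * Z - Const a * (X * Y) \<in> jacobian_ideal (hesse_cubic a)"
    using jacobian_ideal_cancel[of 3 _ "hesse_cubic a"] jacobian_ideal_pdiff[of _ "hesse_cubic a"]
    by (metis zero_neq_numeral)+
qed

text \<open>
  The eight monomials are those not divisible by a square. They span the quotient by the
  Jacobian ideal of a smooth Hesse cubic, with \<open>xyz\<close> spanning the socle.
\<close>

definition socle_form :: "complex \<Rightarrow> complex \<Rightarrow> complex \<Rightarrow> complex \<Rightarrow> complex \<Rightarrow> complex \<Rightarrow> complex \<Rightarrow> complex \<Rightarrow> tpoly" where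
  "socle_form c0 c1 c2 c3 c4 c5 c6 c7 = Const c0 + Const c1 * Var 1 + Const c2 * Var 2 + Const c3 * Var 3
     + Const c4 * (Var 2 * Var 3) + Const c5 * (Var 1 * Var 3) + Const c6 * (Var 1 * Var 2)
     + Const c7 * (Var 1 * Var 2 * Var 3)"

lemma hesse_jacobian_normal_form:
  assumes a: "a ^ 3 \<noteq> 1"
  shows "\<exists>c0 c1 c2 c3 c4 c5 c6 c7. p - socle_form c0 c1 c2 c3 c4 c5 c6 c7 \<in> jacobian_ideal (hesse_cubic a)"
proof -
  define X Y Z A where XYZ: "X = Var 1" "Y = Var 2" "Z = Var 3" "A = Const a"
  let ?I = "jacobian_ideal (hesse_cubic a)"
  note r = jacobian_ideal_hesse_relations[of a, folded XYZ]
  note mixed = mixed_cube_in_jacobian_ideal[of _ a _ _ "hesse_cubic a", folded XYZ, OF _ _ _ a]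
  have m: "X * X * Y \<in> ?I" "X * X * Z \<in> ?I" "Y * Y * X \<in> ?I" "Y * Y * Z \<in> ?I" "Z * Z * X \<in> ?I" "Z * Z * Y \<in> ?I"
    by (rule mixed; use r in \<open>simp add: mult.commute\<close>)+
  show ?thesis
  proof (induction p rule: tpoly_induct_Var)
    case (Const c)
    show ?case
      by (rule exI[of _ c], (rule exI[of _ 0])+) (simp add: socle_form_def jacobian_ideal_0)
  next
    case (add p q)
    then obtain c0 c1 c2 c3 c4 c5 c6 c7 d0 d1 d2 d3 d4 d5 d6 d7
      where "p - socle_form c0 c1 c2 c3 c4 c5 c6 c7 \<in> ?I" "q - socle_form d0 d1 d2 d3 d4 d5 d6 d7 \<in> ?I"
      by blast
    then have "(p - socle_form c0 c1 c2 c3 c4 c5 c6 c7) + (q - socle_form d0 d1 d2 d3 d4 d5 d6 d7) \<in> ?I"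
      by (rule jacobian_ideal_add)
    also have "(p - socle_form c0 c1 c2 c3 c4 c5 c6 c7) + (q - socle_form d0 d1 d2 d3 d4 d5 d6 d7)
      = p + q - socle_form (c0 + d0) (c1 + d1) (c2 + d2) (c3 + d3) (c4 + d4) (c5 + d5) (c6 + d6) (c7 + d7)"
      by (simp add: socle_form_def Const_add algebra_simps)
    finally show ?case by blast
  next
    case (Var_mult i p)
    then obtain c0 c1 c2 c3 c4 c5 c6 c7 where p: "p - socle_form c0 c1 c2 c3 c4 c5 c6 c7 \<in> ?I" by blast
    let ?q = "p - socle_form c0 c1 c2 c3 c4 c5 c6 c7"
    have 1: "X * p - socle_form 0 c0 0 0 (a * c1) c3 c2 c4 = X * ?q + Const c1 * (X * X - A * (Y * Z))
        + Const c5 * (X * X * Z) + Const c6 * (X * X * Y) + Const c7 * Z * (X * X * Y)"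
      by (simp add: socle_form_def XYZ Const_mult algebra_simps)
    have 2: "Y * p - socle_form 0 0 c0 0 c3 (a * c2) c1 c5 = Y * ?q + Const c2 * (Y * Y - A * (X * Z))
        + Const c4 * (Y * Y * Z) + Const c6 * (Y * Y * X) + Const c7 * Z * (Y * Y * X)"
      by (simp add: socle_form_def XYZ Const_mult algebra_simps)
    have 3: "Z * p - socle_form 0 0 0 c0 c2 c1 (a * c3) c6 = Z * ?q + Const c3 * (Z * Z - A * (X * Y))
        + Const c4 * (Z * Z * Y) + Const c5 * (Z * Z * X) + Const c7 * Y * (Z * Z * X)"
      by (simp add: socle_form_def XYZ Const_mult algebra_simps)
    have "X * p - socle_form 0 c0 0 0 (a * c1) c3 c2 c4 \<in> ?I"
      "Y * p - socle_form 0 0 c0 0 c3 (a * c2) c1 c5 \<in> ?I"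
      "Z * p - socle_form 0 0 0 c0 c2 c1 (a * c3) c6 \<in> ?I"
      unfolding 1 2 3 by (intro jacobian_ideal_add jacobian_ideal_mult p m r)+
    then show ?case using exhaust_3[of i] unfolding XYZ by metis
  qed
qed

text \<open>
  The generators of the ideal annihilate the given cubic \<open>g\<close>. For the converse it is enough that no
  nonzero combination of the eight square-free monomials annihilates \<open>g\<close>; the term \<open>6xyz\<close> of \<open>g\<close>
  pairs each of these monomials with its complement in \<open>xyz\<close>, which recovers each coefficient.
\<close>

lemma jacobian_ideal_hesse_eq_perp:
  assumes a: "a ^ 3 \<noteq> 1"
  shows "jacobian_ideal (hesse_cubic a) = perp (pencil a 6)"
proof -
  let ?I = "jacobian_ideal (hesse_cubic a)"
  have gens: "diff_act (pdiff i (hesse_cubic a)) (pencil a 6) = 0" for i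
  proof -
    have "diff_act (pdiff i (hesse_cubic a)) (pencil a 6) = 0" if "i = 1 \<or> i = 2 \<or> i = 3"
      using that
      by (elim disjE)
        (simp_all add: hesse_cubic_def pencil_def power2_eq_square diff_act_mult Const_mult
          algebra_simps)
    then show ?thesis using exhaust_3[of i] by blast
  qed
  have sub: "diff_act p (pencil a 6) = 0" if "p \<in> ?I" for p
    using that by (auto simp: jacobian_ideal_def diff_act_sum diff_act_mult gens)
  show ?thesis
  proof (intro equalityI subsetI)
    fix p assume "p \<in> perp (pencil a 6)"
    then have p: "diff_act p (pencil a 6) = 0" by (simp add: perp_def)
    obtain c0 c1 c2 c3 c4 c5 c6 c7 where nf: "p - socle_form c0 c1 c2 c3 c4 c5 c6 c7 \<in> ?I"
      using hesse_jacobian_normal_form[OF a] by blast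
    define G where "G = diff_act (socle_form c0 c1 c2 c3 c4 c5 c6 c7) (pencil a 6)"
    have "G = 0" using sub[OF nf] p by (simp add: G_def)
    have G: "G = Const c0 * pencil a 6 + Const c1 * (Const (3 * a) * Var 1 ^ 2 + Const 6 * (Var 2 * Var 3))
       + Const c2 * (Const (3 * a) * Var 2 ^ 2 + Const 6 * (Var 1 * Var 3))
       + Const c3 * (Const (3 * a) * Var 3 ^ 2 + Const 6 * (Var 1 * Var 2))
       + Const (6 * c4) * Var 1 + Const (6 * c5) * Var 2 + Const (6 * c6) * Var 3 + Const (6 * c7)"
      by (simp add: G_def socle_form_def pencil_def diff_act_mult Const_mult power2_eq_square algebra_simps)
    \<comment> \<open>The value at the origin of a derivative of the result isolates one coefficient.\<close>
    have c: "eval_at (pdiff 1 (pdiff 2 (pdiff 3 G))) 0 = 6 * c0"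
      "eval_at (pdiff 2 (pdiff 3 G)) 0 = 6 * c1" "eval_at (pdiff 1 (pdiff 3 G)) 0 = 6 * c2"
      "eval_at (pdiff 1 (pdiff 2 G)) 0 = 6 * c3" "eval_at (pdiff 1 G) 0 = 6 * c4"
      "eval_at (pdiff 2 G) 0 = 6 * c5" "eval_at (pdiff 3 G) 0 = 6 * c6" "eval_at G 0 = 6 * c7"
      by (simp_all add: G pencil_def)
    have "c0 = 0" "c1 = 0" "c2 = 0" "c3 = 0" "c4 = 0" "c5 = 0" "c6 = 0" "c7 = 0"
      using c unfolding \<open>G = 0\<close> by simp_all
    then show "p \<in> ?I" using nf by (simp add: socle_form_def)
  qed (auto simp: perp_def sub)
qed

text \<open>
  The monomials \<open>x\<^sup>2y\<close> and the forms \<open>x\<^sup>3 - axyz\<close>, together with their images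
  under permuting the variables, lie in the ideal; that they annihilate \<open>g\<close> is a linear system for the ten coefficients with a one-dimensional solution space.
\<close>

lemma perp_hesse_unique:
  assumes a: "a ^ 3 \<noteq> 1" and J: "jacobian_ideal (hesse_cubic a) = perp g"
    and g: "homogeneous 3 g" "g \<noteq> 0"
  obtains d where "d \<noteq> 0" "g = Const d * pencil a 6"
proof -
  let ?I = "jacobian_ideal (hesse_cubic a)"
  obtain a1 a2 a3 a4 a5 a6 a7 a8 a9 a10 where g_eq:
   "g = Const a1 * Var 1 ^ 3 + Const a2 * Var 2 ^ 3 + Const a3 * Var 3 ^ 3
      + Const a4 * Var 1 ^ 2 * Var 2 + Const a5 * Var 1 ^ 2 * Var 3
      + Const a6 * Var 2 ^ 2 * Var 1 + Const a7 * Var 2 ^ 2 * Var 3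
      + Const a8 * Var 3 ^ 2 * Var 1 + Const a9 * Var 3 ^ 2 * Var 2
      + Const a10 * Var 1 * Var 2 * Var 3"
    by (rule homogeneous_3_expand[OF g(1)])
  have ann: "eval_at (diff_act q (diff_act p g)) 0 = 0" if "p \<in> ?I" for p q
    using that unfolding J perp_def by simp
  note r = jacobian_ideal_hesse_relations[of a]
  have sq: "6 * a1 = a * a10" "6 * a2 = a * a10" "6 * a3 = a * a10"
    using ann[OF r(1), of "Var 1"] ann[OF r(2), of "Var 2"] ann[OF r(3), of "Var 3"]
    by (simp_all add: g_eq diff_act_mult power2_eq_square algebra_simps)
  have m: "Var 1 * Var 1 * Var 2 \<in> ?I" "Var 1 * Var 1 * Var 3 \<in> ?I" "Var 2 * Var 2 * Var 1 \<in> ?I"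
      "Var 2 * Var 2 * Var 3 \<in> ?I" "Var 3 * Var 3 * Var 1 \<in> ?I" "Var 3 * Var 3 * Var 2 \<in> ?I"
    by (rule mixed_cube_in_jacobian_ideal[OF _ _ _ a]; use r in \<open>simp add: mult.commute\<close>)+
  have mix: "a4 = 0" "a5 = 0" "a6 = 0" "a7 = 0" "a8 = 0" "a9 = 0"
    using ann[OF m(1), of 1] ann[OF m(2), of 1] ann[OF m(3), of 1]
      ann[OF m(4), of 1] ann[OF m(5), of 1] ann[OF m(6), of 1]
    by (simp_all add: g_eq diff_act_mult power2_eq_square algebra_simps)
  have eq: "g = Const (a10 / 6) * pencil a 6"
  proof (rule eval_at_injective)
    have sq': "a1 = a * a10 / 6" "a2 = a * a10 / 6" "a3 = a * a10 / 6"
      using sq by (simp_all add: field_simps)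
    show "eval_at g v = eval_at (Const (a10 / 6) * pencil a 6) v" for v
      by (simp add: g_eq mix sq' pencil_def algebra_simps)
  qed
  moreover have "a10 \<noteq> 0" using eq g(2) by auto
  ultimately show ?thesis by (intro that[of "a10 / 6"]) auto
qed

text \<open>
  Existence of a Macaulay polynomial is transported from the Hesse cubic to \<open>f\<close>, which
  makes the choice in \<open>Mac f\<close> meaningful; the chosen polynomial is transported back, where
  uniqueness identifies it.
\<close>

lemma Mac_proj_equiv:
  assumes f: "proj_equiv f (hesse_cubic a)" and a: "a ^ 3 \<noteq> 1"
  shows "proj_equiv (Mac f) (pencil a 6)"
proof -
  obtain B A c where BA: "B ** A = mat 1" "A ** B = mat 1" and c: "c \<noteq> 0"
    and h: "hesse_cubic a = Const c * lin_subst B f"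
    and fh: "f = Const (inverse c) * lin_subst A (hesse_cubic a)"
    using f by (rule proj_equivE)
  define P where "P g \<longleftrightarrow> g \<noteq> 0 \<and> homogeneous 3 g \<and> jacobian_ideal f = perp g" for g
  have inv: "transpose A ** transpose B = mat 1" "transpose B ** transpose A = mat 1"
    using BA by (simp_all flip: matrix_transpose_mul)
  have "jacobian_ideal f = perp (lin_subst (transpose B) (pencil a 6))"
    unfolding fh using jacobian_ideal_hesse_eq_perp[OF a] BA(2,1) c
    by (intro jacobian_ideal_eq_perp_lin_subst) auto
  moreover have "lin_subst (transpose B) (pencil a 6) \<noteq> 0"
    using lin_subst_inverse[OF inv(2), of "pencil a 6"] by (auto simp: pencil_eq_0_iff)
  ultimately have "P (lin_subst (transpose B) (pencil a 6))"
    by (simp add: P_def homogeneous_lin_subst homogeneous_pencil)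
  then have "P (Mac f)" unfolding Mac_def P_def[symmetric] by (rule someI)
  then have M: "Mac f \<noteq> 0" "homogeneous 3 (Mac f)" "jacobian_ideal f = perp (Mac f)"
    by (simp_all add: P_def)
  have "jacobian_ideal (hesse_cubic a) = perp (lin_subst (transpose A) (Mac f))"
    unfolding h using M(3) BA c by (rule jacobian_ideal_eq_perp_lin_subst)
  moreover have "lin_subst (transpose A) (Mac f) \<noteq> 0"
    using lin_subst_inverse[OF inv(1), of "Mac f"] M(1) by auto
  ultimately obtain d where d: "d \<noteq> 0" "lin_subst (transpose A) (Mac f) = Const d * pencil a 6"
    using perp_hesse_unique[OF a] homogeneous_lin_subst[OF M(2)] by metis
  then have "pencil a 6 = Const (inverse d) * lin_subst (transpose A) (Mac f)"
    by (simp add: Const_cancel)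
  then show ?thesis
    using M d(1) inv by (intro proj_equivI[where B = "transpose A" and c = "inverse d"]) (auto simp: invertible_def)
qed

lemma Hess_proj_equiv:
  assumes "proj_equiv f (hesse_cubic a)" "a ^ 3 \<noteq> 1"
  shows "proj_equiv (Hess f) (pencil (- 54 * a ^ 2) (216 - 54 * a ^ 3))"
proof -
  obtain B A c where BA: "B ** A = mat 1" "A ** B = mat 1" and c: "c \<noteq> 0"
    and f: "f = Const (inverse c) * lin_subst A (hesse_cubic a)"
    using assms(1) by (rule proj_equivE)
  have H: "Hess (hesse_cubic a) = pencil (- 54 * a ^ 2) (216 - 54 * a ^ 3)"
    unfolding hesse_cubic_eq_pencil Hess_pencil by (simp add: power2_eq_square power3_eq_cube mult.assoc)
  have "det A \<noteq> 0" using BA by (metis det_I det_mul mult_zero_right zero_neq_one mult_zero_left)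
  have "pencil (- 54 * a ^ 2) (216 - 54 * a ^ 3) \<noteq> 0"
    unfolding pencil_eq_0_iff by auto
  moreover have "Hess f = Const (inverse c ^ 3 * det A ^ 2) * lin_subst A (pencil (- 54 * a ^ 2) (216 - 54 * a ^ 3))"
    unfolding f Hess_Const_mult Hess_lin_subst H Const_mult by (simp add: mult.assoc)
  ultimately show ?thesis
    using BA c \<open>det A \<noteq> 0\<close> homogeneous_pencil
    by (intro proj_equiv_sym[OF proj_equivI[where B = A and c = "inverse c ^ 3 * det A ^ 2"]]) (auto simp: invertible_def)
qed

section \<open>Invariance of \<open>j\<close> on the Hesse pencil\<close>

definition hesse_j :: "complex \<Rightarrow> complex" where
  "hesse_j a = - (a ^ 3 * (a ^ 3 + 8) ^ 3 / (1 - a ^ 3) ^ 3)"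

lemma lin_subst_pencil_linear:
  assumes 1: "lin_subst B (pencil s1 t1) = pencil s1' t1'" and 2: "lin_subst B (pencil s2 t2) = pencil s2' t2'"
    and d: "s1 * t2 - s2 * t1 \<noteq> 0"
  obtains p q r u where "\<And>s t. lin_subst B (pencil s t) = pencil (p * s + q * t) (r * s + u * t)"
proof -
  define e where "e = inverse (s1 * t2 - s2 * t1)"
  have e: "e * (s1 * t2 - s2 * t1) = 1" using d by (simp add: e_def)
  have "lin_subst B (pencil s t) = pencil (e * (t2 * s1' - t1 * s2') * s + e * (s1 * s2' - s2 * s1') * t)
        (e * (t2 * t1' - t1 * t2') * s + e * (s1 * t2' - s2 * t1') * t)" for s t
  proof -
    define l n where "l = e * (t2 * s - s2 * t)" and "n = e * (s1 * t - t1 * s)"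
    have "pencil s t = Const l * pencil s1 t1 + Const n * pencil s2 t2"
      unfolding Const_mult_pencil pencil_add pencil_inject l_def n_def using e by algebra
    then have "lin_subst B (pencil s t) = Const l * pencil s1' t1' + Const n * pencil s2' t2'"
      by (simp add: 1 2)
    also have "\<dots> = pencil (e * (t2 * s1' - t1 * s2') * s + e * (s1 * s2' - s2 * s1') * t)
        (e * (t2 * t1' - t1 * t2') * s + e * (s1 * t2' - s2 * t1') * t)"
      unfolding Const_mult_pencil pencil_add pencil_inject l_def n_def by algebra
    finally show ?thesis .
  qed
  then show ?thesis by (rule that)
qed

lemma quartic_coeffs_zero:
  fixes c0 c1 c2 c3 c4 :: complex
  assumes "\<And>s t. c4 * s ^ 4 + c3 * s ^ 3 * t + c2 * s ^ 2 * t ^ 2 + c1 * s * t ^ 3 + c0 * t ^ 4 = 0"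
  shows "c0 = 0" "c1 = 0" "c2 = 0" "c3 = 0" "c4 = 0"
proof -
  show 0: "c0 = 0" using assms[of 0 1] by simp
  show 4: "c4 = 0" using assms[of 1 0] by simp
  have "c3 + c2 + c1 = 0" "c3 * 2 + c2 * 4 + c1 * 8 = 0" "- c3 + c2 - c1 = 0"
    using assms[of 1 1] assms[of 1 2] assms[of "-1" 1] 0 4 by (simp_all add: algebra_simps)
  then show "c1 = 0" "c2 = 0" "c3 = 0" by algebra+
qed

text \<open>
  The binary quartic \<open>27 s\<^sup>4 + s t\<^sup>3\<close> vanishes at the four triangles of the Hesse pencil. Its
  invariant of degree three has weight six, which gives the first claim; its Hessian is a
  multiple of \<open>t(216 s\<^sup>3 - t\<^sup>3)\<close> and has weight two, which gives the second claim.
\<close>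

lemma quartic_invariance:
  fixes p q r u m :: complex
  assumes inv: "\<And>s t. 27 * (p * s + q * t) ^ 4 + (p * s + q * t) * (r * s + u * t) ^ 3 = m * (27 * s ^ 4 + s * t ^ 3)"
  defines "D \<equiv> p * u - q * r"
  shows "m ^ 3 = D ^ 6"
    and "\<And>s t. D ^ 2 * ((r * s + u * t) * (216 * (p * s + q * t) ^ 3 - (r * s + u * t) ^ 3)) = m ^ 2 * (t * (216 * s ^ 3 - t ^ 3))"
proof -
  define b4 b3 b2 b1 b0 where
    "b4 = 27 * p ^ 4 + p * r ^ 3" and "b3 = 108 * p ^ 3 * q + q * r ^ 3 + 3 * p * r ^ 2 * u" and
    "b2 = 162 * p ^ 2 * q ^ 2 + 3 * q * r ^ 2 * u + 3 * p * r * u ^ 2" and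
    "b1 = 108 * p * q ^ 3 + 3 * q * r * u ^ 2 + p * u ^ 3" and "b0 = 27 * q ^ 4 + q * u ^ 3"
  note b = b4_def b3_def b2_def b1_def b0_def
  have "(b4 - 27 * m) * s ^ 4 + b3 * s ^ 3 * t + b2 * s ^ 2 * t ^ 2 + (b1 - m) * s * t ^ 3 + b0 * t ^ 4 = 0" for s t
    using inv[of s t] unfolding b by algebra
  from quartic_coeffs_zero[OF this]
  have z: "b4 = 27 * m" "b3 = 0" "b2 = 0" "b1 = m" "b0 = 0" by simp_all
  \<comment> \<open>The left side is the catalecticant of the transformed quartic, without binomial denominators.\<close>
  have "72 * b4 * b2 * b0 + 9 * b3 * b2 * b1 - 2 * b2 ^ 3 - 27 * b4 * b1 ^ 2 - 27 * b3 ^ 2 * b0 = - 729 * D ^ 6"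
    unfolding b D_def by algebra
  then show "m ^ 3 = D ^ 6" unfolding z by (simp add: power2_eq_square power3_eq_cube mult.assoc)
  fix s t
  \<comment> \<open>The left side is the Hessian of the transformed quartic.\<close>
  have "(8 * b4 * b2 - 3 * b3 ^ 2) * s ^ 4 + (24 * b4 * b1 - 4 * b3 * b2) * s ^ 3 * t
      + (48 * b4 * b0 + 6 * b3 * b1 - 4 * b2 ^ 2) * s ^ 2 * t ^ 2
      + (24 * b3 * b0 - 4 * b2 * b1) * s * t ^ 3 + (8 * b2 * b0 - 3 * b1 ^ 2) * t ^ 4
    = 3 * (D ^ 2 * ((r * s + u * t) * (216 * (p * s + q * t) ^ 3 - (r * s + u * t) ^ 3)))"
    unfolding b D_def by algebra
  then have "3 * (D ^ 2 * ((r * s + u * t) * (216 * (p * s + q * t) ^ 3 - (r * s + u * t) ^ 3)))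
      = 3 * (m ^ 2 * (t * (216 * s ^ 3 - t ^ 3)))"
    unfolding z by (simp add: power2_eq_square power3_eq_cube power4_eq_xxxx algebra_simps)
  then show "D ^ 2 * ((r * s + u * t) * (216 * (p * s + q * t) ^ 3 - (r * s + u * t) ^ 3)) = m ^ 2 * (t * (216 * s ^ 3 - t ^ 3))"
    by (simp only: mult_cancel_left) simp
qed

text \<open>
  The numerator and the denominator are homogeneous of degree twelve in \<open>(s, t)\<close>, so the scalar \<open>l\<close> cancels.
\<close>

lemma hesse_j_eq_covariants:
  assumes "a ^ 3 \<noteq> 1" "l \<noteq> 0"
  defines "s \<equiv> l" and "t \<equiv> - 3 * a * l"
  shows "hesse_j a = (t * (216 * s ^ 3 - t ^ 3)) ^ 3 / (27 * (27 * s ^ 4 + s * t ^ 3) ^ 3)"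
    and "27 * s ^ 4 + s * t ^ 3 \<noteq> 0"
proof -
  have d: "27 * s ^ 4 + s * t ^ 3 = 27 * l ^ 4 * (1 - a ^ 3)"
    unfolding s_def t_def by algebra
  show "27 * s ^ 4 + s * t ^ 3 \<noteq> 0" unfolding d using assms(1,2) by simp
  have n: "t * (216 * s ^ 3 - t ^ 3) = - 81 * l ^ 4 * (a * (a ^ 3 + 8))"
    unfolding s_def t_def by algebra
  show "hesse_j a = (t * (216 * s ^ 3 - t ^ 3)) ^ 3 / (27 * (27 * s ^ 4 + s * t ^ 3) ^ 3)"
    unfolding d n using assms(1,2) by (simp add: hesse_j_def power_mult_distrib)
qed

text \<open>
  The substitution takes \<open>f\<^sub>a\<close> and its Hessian, which span the Hesse pencil, into the pencil, so it acts
  on the pencil by a linear map \<open>L\<close>. If \<open>H\<close> denotes the self-map of the pencil given by the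
  Hessian, then \<open>H \<circ> L = k (L \<circ> H)\<close> with \<open>k = (det B)\<^sup>2\<close>. The determinant of the pair
  \<open>(v, H v)\<close> is \<open>8(27 s\<^sup>4 + s t\<^sup>3)\<close>, so this quartic is multiplied by \<open>k det L\<close> under \<open>L\<close>, and the
  covariants of the quartic finish the proof.
\<close>

lemma hesse_j_proj_invariant:
  assumes eq: "proj_equiv (hesse_cubic a) (hesse_cubic b)" and a: "a ^ 3 \<noteq> 1" and b: "b ^ 3 \<noteq> 1"
  shows "hesse_j a = hesse_j b"
proof -
  obtain B A c where BA: "B ** A = mat 1" and c: "c \<noteq> 0" and hb: "hesse_cubic b = Const c * lin_subst B (hesse_cubic a)"
    using eq by (rule proj_equivE)
  define l where "l = inverse c"
  have l: "l \<noteq> 0" "c * l = 1" using c by (auto simp: l_def)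
  have ha: "lin_subst B (pencil 1 (- 3 * a)) = pencil l (- 3 * b * l)"
  proof -
    have "Const l * hesse_cubic b = lin_subst B (hesse_cubic a)" unfolding hb l_def using c by (rule Const_cancel)
    then show ?thesis by (simp add: hesse_cubic_eq_pencil Const_mult_pencil ac_simps)
  qed
  define k where "k = det B ^ 2"
  have "det B * det A = 1" using BA by (metis det_I det_mul)
  then have "k \<noteq> 0" by (auto simp: k_def)
  have Hk: "lin_subst B (Hess p) = Const (inverse k) * Hess (lin_subst B p)" for p
    unfolding Hess_lin_subst k_def[symmetric] using \<open>k \<noteq> 0\<close> by (simp add: Const_cancel)
  obtain h1 h2 where h: "lin_subst B (pencil (- 6 * 1 * (- 3 * a) ^ 2) (216 * 1 ^ 3 + 2 * (- 3 * a) ^ 3)) = pencil h1 h2"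
    using Hk[of "pencil 1 (- 3 * a)"] unfolding ha Hess_pencil Const_mult_pencil by blast
  \<comment> \<open>The Hesse cubic and its Hessian are linearly independent.\<close>
  have "1 * (216 * 1 ^ 3 + 2 * (- 3 * a) ^ 3) - (- 6 * 1 * (- 3 * a) ^ 2) * (- 3 * a) = 216 * (1 - a ^ 3)"
    by (simp add: power2_eq_square power3_eq_cube)
  moreover have "216 * (1 - a ^ 3) \<noteq> 0" using a by simp
  ultimately have "1 * (216 * 1 ^ 3 + 2 * (- 3 * a) ^ 3) - (- 6 * 1 * (- 3 * a) ^ 2) * (- 3 * a) \<noteq> 0" by metis
  then obtain p q r u where L: "\<And>s t. lin_subst B (pencil s t) = pencil (p * s + q * t) (r * s + u * t)"
    using lin_subst_pencil_linear[OF ha h] by blast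
  define D where "D = p * u - q * r"
  have Hess_L: "- 6 * (p * s + q * t) * (r * s + u * t) ^ 2 = k * (p * (- 6 * s * t ^ 2) + q * (216 * s ^ 3 + 2 * t ^ 3))"
    "216 * (p * s + q * t) ^ 3 + 2 * (r * s + u * t) ^ 3 = k * (r * (- 6 * s * t ^ 2) + u * (216 * s ^ 3 + 2 * t ^ 3))" for s t
    using Hess_lin_subst[of B "pencil s t"]
    unfolding L Hess_pencil Const_mult_pencil pencil_inject k_def[symmetric] by blast+
  have inv: "27 * (p * s + q * t) ^ 4 + (p * s + q * t) * (r * s + u * t) ^ 3 = (k * D) * (27 * s ^ 4 + s * t ^ 3)" for s t
    using Hess_L[of s t] unfolding D_def by algebra
  note Q = quartic_invariance[OF inv, folded D_def]
  have st: "p * 1 + q * (- 3 * a) = l" "r * 1 + u * (- 3 * a) = - 3 * b * l"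
    using ha unfolding L pencil_inject by simp_all
  define N1 d1 N2 d2 where "N1 = - 3 * a * 1 * (216 * 1 ^ 3 - (- 3 * a * 1) ^ 3)"
    and "d1 = 27 * 1 ^ 4 + 1 * (- 3 * a * 1) ^ 3"
    and "N2 = - 3 * b * l * (216 * l ^ 3 - (- 3 * b * l) ^ 3)"
    and "d2 = 27 * l ^ 4 + l * (- 3 * b * l) ^ 3"
  have ja: "hesse_j a = N1 ^ 3 / (27 * d1 ^ 3)"
    unfolding N1_def d1_def using hesse_j_eq_covariants(1)[OF a one_neq_zero] .
  have jb: "hesse_j b = N2 ^ 3 / (27 * d2 ^ 3)" and d2: "d2 \<noteq> 0"
    unfolding N2_def d2_def using hesse_j_eq_covariants[OF b l(1)] by blast+
  have d: "d2 = k * D * d1"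
    using inv[of 1 "- 3 * a"] unfolding st d1_def d2_def by simp
  have N: "D ^ 2 * N2 = (k * D) ^ 2 * N1"
    using Q(2)[of 1 "- 3 * a"] unfolding st N1_def N2_def by simp
  have m: "k * D \<noteq> 0" using d d2 by auto
  have "(k * D) ^ 3 * N2 ^ 3 = (k * D) ^ 6 * N1 ^ 3" using N Q(1) by algebra
  then have "(k * D) ^ 3 * N2 ^ 3 = (k * D) ^ 3 * ((k * D) ^ 3 * N1 ^ 3)" by algebra
  then have "N2 ^ 3 = (k * D) ^ 3 * N1 ^ 3" by (rule iffD1[OF mult_left_cancel[OF power_not_zero[OF m]]])
  then show ?thesis unfolding ja jb d using m by (simp add: power_mult_distrib)
qed

section \<open>Weierstrass form and classification by \<open>j\<close>\<close>

text \<open>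
  The usual form \<open>y\<^sup>2z = x\<^sup>3 + \<dots>\<close> arises by multiplying \<open>y\<close> by \<open>\<i>\<close>; the present sign avoids
  minus signs in the identities below.
\<close>

definition weierstrass_cubic :: "complex \<Rightarrow> complex \<Rightarrow> tpoly" where
  "weierstrass_cubic p q = Var 2 ^ 2 * Var 3 + Var 1 ^ 3 + Const p * Var 1 * Var 3 ^ 2 + Const q * Var 3 ^ 3"

lemma eval_at_weierstrass: "eval_at (weierstrass_cubic p q) v
    = v $ 2 ^ 2 * v $ 3 + v $ 1 ^ 3 + p * v $ 1 * v $ 3 ^ 2 + q * v $ 3 ^ 3"
  by (simp add: weierstrass_cubic_def)

lemma weierstrass_cubic_nonzero: "weierstrass_cubic p q \<noteq> 0"
proof
  assume "weierstrass_cubic p q = 0"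
  from arg_cong[OF this, of "\<lambda>f. eval_at f (vector [1, 0, 0])"] show False
    by (simp add: eval_at_weierstrass)
qed

lemma homogeneous_weierstrass: "homogeneous 3 (weierstrass_cubic p q)"
proof -
  have p: "homogeneous (n * 1) (Var i ^ n)" for i n by (rule homogeneous_power[OF homogeneous_Var])
  have "homogeneous (2 * 1 + 1) (Var 2 ^ 2 * Var 3)" "homogeneous (0 + 1 + 2 * 1) (Const p * Var 1 * Var 3 ^ 2)"
    by (intro homogeneous_mult homogeneous_Const homogeneous_Var p)+
  then show ?thesis
    unfolding weierstrass_cubic_def using p[where n = 3]
    by (intro homogeneous_add homogeneous_Const_mult) (simp_all add: numeral_3_eq_3)
qed

lemma complex_root_exists:
  assumes "n > 0" obtains w :: complex where "w ^ n = z"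
proof -
  have "degree (monom 1 n + [:- z:]) = n"
    using assms by (simp add: degree_add_eq_left degree_monom_eq)
  then have "\<not> constant (poly (monom 1 n + [:- z:]))"
    using assms by (simp add: constant_degree)
  then obtain w where "poly (monom 1 n + [:- z:]) w = 0" using fundamental_theorem_of_algebra by blast
  then show ?thesis using that by (simp add: poly_monom)
qed

lemma invertible_matrix_3:
  fixes B :: "complex ^ 3 ^ 3"
  assumes "B = vector [vector [b11, b12, b13], vector [b21, b22, b23], vector [b31, b32, b33]]"
    "b11 * (b22 * b33 - b23 * b32) - b12 * (b21 * b33 - b23 * b31) + b13 * (b21 * b32 - b22 * b31) \<noteq> 0"
  shows "invertible B"
proof -
  have "det B = b11 * (b22 * b33 - b23 * b32) - b12 * (b21 * b33 - b23 * b31) + b13 * (b21 * b32 - b22 * b31)"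
    unfolding assms(1) det_3 by (simp add: algebra_simps)
  then show ?thesis using assms(2) by (simp add: invertible_det_nz)
qed

lemma proj_equiv_substI:
  assumes "p \<noteq> 0" "homogeneous d p" "c \<noteq> 0"
    "b11 * (b22 * b33 - b23 * b32) - b12 * (b21 * b33 - b23 * b31) + b13 * (b21 * b32 - b22 * b31) \<noteq> 0"
    "\<And>x y z. eval_at q (vector [x, y, z]) = c * eval_at p (vector [b11 * x + b12 * y + b13 * z,
       b21 * x + b22 * y + b23 * z, b31 * x + b32 * y + b33 * z])"
  shows "proj_equiv p q"
proof -
  define B where "B = (vector [vector [b11, b12, b13], vector [b21, b22, b23], vector [b31, b32, b33]] :: complex^3^3)"
  have "eval_at q v = c * eval_at p (B *v v)" for v
  proof -
    have v: "v = vector [v $ 1, v $ 2, v $ 3]" by (simp add: vec_eq_iff forall_3)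
    have Bv: "B *v v = vector [b11 * v $ 1 + b12 * v $ 2 + b13 * v $ 3,
       b21 * v $ 1 + b22 * v $ 2 + b23 * v $ 3, b31 * v $ 1 + b32 * v $ 2 + b33 * v $ 3]"
      by (simp add: vec_eq_iff forall_3 matrix_vector_mult_def sum_3 B_def)
    show ?thesis unfolding Bv by (subst v) (rule assms(5))
  qed
  then show ?thesis
    using assms(1-4) invertible_matrix_3[OF B_def] by (intro proj_equiv_evalI[where B = B and c = c]) auto
qed

text \<open>
  Replacing \<open>z\<close> by \<open>m z\<close> and \<open>y\<close> by \<open>y / \<surd>m\<close> multiplies \<open>p\<close> by \<open>m\<^sup>2\<close> and \<open>q\<close> by \<open>m\<^sup>3\<close>. The equation
  between the coefficients says that a suitable \<open>m\<close> exists; when \<open>p\<close> or \<open>q\<close> vanishes, \<open>m\<close> is a root.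
\<close>

lemma weierstrass_rescale:
  assumes d: "4 * p ^ 3 + 27 * q ^ 2 \<noteq> 0" and d': "4 * p' ^ 3 + 27 * q' ^ 2 \<noteq> 0"
    and eq: "p ^ 3 * q' ^ 2 = p' ^ 3 * q ^ 2"
  shows "proj_equiv (weierstrass_cubic p q) (weierstrass_cubic p' q')"
proof -
  obtain m where m: "m \<noteq> 0" "p' = m ^ 2 * p" "q' = m ^ 3 * q"
  proof -
    consider "p = 0" | "q = 0" | "p \<noteq> 0" "q \<noteq> 0" by blast
    then show ?thesis
    proof cases
      case 1
      then have q: "q \<noteq> 0" using d by auto
      then have "p' = 0" using eq 1 by auto
      then have "q' \<noteq> 0" using d' by auto
      obtain m where "m ^ 3 = q' / q" by (rule complex_root_exists[of 3]) auto
      then show ?thesis using that[of m] q 1 \<open>p' = 0\<close> \<open>q' \<noteq> 0\<close> by (auto simp: field_simps)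
    next
      case 2
      then have p: "p \<noteq> 0" using d by auto
      then have "q' = 0" using eq 2 by auto
      then have "p' \<noteq> 0" using d' by auto
      obtain m where "m ^ 2 = p' / p" by (rule complex_root_exists[of 2]) auto
      then show ?thesis using that[of m] p 2 \<open>q' = 0\<close> \<open>p' \<noteq> 0\<close> by (auto simp: field_simps)
    next
      case 3
      have "p' \<noteq> 0 \<and> q' \<noteq> 0"
      proof (rule ccontr)
        assume "\<not> ?thesis"
        then have "p' = 0 \<and> q' = 0" using eq 3 by auto
        then show False using d' by simp
      qed
      define m where "m = q' * p / (q * p')"
      have m: "m * (q * p') = q' * p" using 3 \<open>p' \<noteq> 0 \<and> q' \<noteq> 0\<close> by (simp add: m_def)
      have "m \<noteq> 0" using 3 \<open>p' \<noteq> 0 \<and> q' \<noteq> 0\<close> by (simp add: m_def)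
      moreover have "p' * (q * p') ^ 2 = m ^ 2 * p * (q * p') ^ 2" using m eq by algebra
      then have "p' = m ^ 2 * p" using 3 \<open>p' \<noteq> 0 \<and> q' \<noteq> 0\<close> by simp
      moreover have "q' * (q * p') ^ 3 = m ^ 3 * q * (q * p') ^ 3" using m eq by algebra
      then have "q' = m ^ 3 * q" using 3 \<open>p' \<noteq> 0 \<and> q' \<noteq> 0\<close> by simp
      ultimately show ?thesis by (rule that)
    qed
  qed
  obtain n where n: "n ^ 2 = m" by (rule complex_root_exists[of 2]) auto
  have "n \<noteq> 0" using n m(1) by auto
  define i where "i = inverse n"
  have i: "i * n = 1" using \<open>n \<noteq> 0\<close> by (simp add: i_def)
  show ?thesis
  proof (rule proj_equiv_substI[where d = 3 and c = 1 and ?b11.0 = 1 and ?b12.0 = 0 and ?b13.0 = 0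
        and ?b21.0 = 0 and ?b22.0 = i and ?b23.0 = 0 and ?b31.0 = 0 and ?b32.0 = 0 and ?b33.0 = m])
    fix x y z
    have "y ^ 2 * z = (i * y) ^ 2 * (m * z)" using i n by algebra
    then show "eval_at (weierstrass_cubic p' q') (vector [x, y, z]) = 1 * eval_at (weierstrass_cubic p q)
        (vector [1 * x + 0 * y + 0 * z, 0 * x + i * y + 0 * z, 0 * x + 0 * y + m * z])"
      by (simp add: eval_at_weierstrass m power_mult_distrib power2_eq_square power3_eq_cube)
  qed (use i m in \<open>auto simp: weierstrass_cubic_nonzero homogeneous_weierstrass\<close>)
qed

text \<open>
  The line \<open>w = x + y + az = 0\<close> is the tangent at the flex \<open>(1 : -1 : 0)\<close>. In the coordinates
  \<open>v = x - y\<close>, \<open>w\<close>, \<open>z\<close> four times the cubic is \<open>3v\<^sup>2w\<close> plus a binary cubic in \<open>w\<close> and \<open>z\<close>, so only the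
  term \<open>w z\<^sup>2\<close> must be removed, by shifting \<open>z\<close>, and the leading coefficients normalised.
\<close>

lemma hesse_proj_equiv_weierstrass:
  assumes a: "a ^ 3 \<noteq> 1"
  obtains p q where "proj_equiv (weierstrass_cubic p q) (hesse_cubic a)"
    "4 * p ^ 3 + 27 * q ^ 2 \<noteq> 0" "256 * p ^ 3 = hesse_j a * (4 * p ^ 3 + 27 * q ^ 2)"
proof -
  define k i where "k = 1 - a ^ 3" and "i = inverse k"
  have k: "k \<noteq> 0" "k * i = 1" using a by (auto simp: k_def i_def)
  obtain s where s: "s ^ 3 = 4 * k" by (rule complex_root_exists[of 3]) auto
  have "s \<noteq> 0" using s k by auto
  define e where "e = inverse s"
  have e: "s * e = 1" using \<open>s \<noteq> 0\<close> by (simp add: e_def)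
  obtain r where r: "r ^ 2 = (3 :: complex)" by (rule complex_root_exists[of 2]) auto
  have "r \<noteq> 0" using r by auto
  \<comment> \<open>The shift \<open>z = Z + m w\<close> that removes the term \<open>w Z\<^sup>2\<close>.\<close>
  define m where "m = - 3 * a ^ 2 * i / 4"
  define p q where "p = - 3 * a * (a ^ 3 + 8) * i / 4 * e" and "q = - (a ^ 6 - 20 * a ^ 3 - 8) * i ^ 2 / 8"
  have p3: "256 * p ^ 3 = - 27 * a ^ 3 * (a ^ 3 + 8) ^ 3 * i ^ 4"
  proof -
    have "e ^ 3 * (4 * k) = 1" using e s by algebra
    then have "e ^ 3 * 4 = i" using k by algebra
    have "256 * p ^ 3 = - 27 * a ^ 3 * (a ^ 3 + 8) ^ 3 * i ^ 3 * (e ^ 3 * 4)"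
      unfolding p_def by (simp add: power3_eq_cube)
    also have "\<dots> = - 27 * a ^ 3 * (a ^ 3 + 8) ^ 3 * i ^ 4"
      unfolding \<open>e ^ 3 * 4 = i\<close> by (simp add: power3_eq_cube power4_eq_xxxx)
    finally show ?thesis .
  qed
  have q2: "64 * q ^ 2 = (a ^ 6 - 20 * a ^ 3 - 8) ^ 2 * i ^ 4"
    unfolding q_def
    by (simp add: power_mult_distrib power_divide power2_commute[of 8 "a ^ 6 - 20 * a ^ 3"])
  have disc: "4 * p ^ 3 + 27 * q ^ 2 = 27 * i"
  proof -
    have "64 * (4 * p ^ 3 + 27 * q ^ 2) = 27 * ((a ^ 6 - 20 * a ^ 3 - 8) ^ 2 - a ^ 3 * (a ^ 3 + 8) ^ 3) * i ^ 4"
      using p3 q2 by algebra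
    also have "(a ^ 6 - 20 * a ^ 3 - 8) ^ 2 - a ^ 3 * (a ^ 3 + 8) ^ 3 = 64 * k ^ 3"
      unfolding k_def by algebra
    also have "27 * (64 * k ^ 3) * i ^ 4 = 64 * (27 * i)" using k(2) by algebra
    finally show ?thesis by (rule iffD1[OF mult_left_cancel, rotated]) simp
  qed
  have "hesse_j a = - (a ^ 3 * (a ^ 3 + 8) ^ 3 * i ^ 3)"
    by (simp add: hesse_j_def i_def k_def divide_inverse power_inverse)
  then have "256 * p ^ 3 = hesse_j a * (4 * p ^ 3 + 27 * q ^ 2)"
    unfolding p3 disc by algebra
  moreover have "4 * p ^ 3 + 27 * q ^ 2 \<noteq> 0" unfolding disc using k by (simp add: i_def)
  moreover have "proj_equiv (weierstrass_cubic p q) (hesse_cubic a)"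
  proof (rule proj_equiv_substI[where d = 3 and c = "1 / 4" and ?b11.0 = "- s * m" and ?b12.0 = "- s * m"
        and ?b13.0 = "s * (1 - m * a)" and ?b21.0 = r and ?b22.0 = "- r" and ?b23.0 = 0
        and ?b31.0 = 1 and ?b32.0 = 1 and ?b33.0 = a])
    have "(- s * m) * (- r * a - 0 * 1) - (- s * m) * (r * a - 0 * 1) + (s * (1 - m * a)) * (r * 1 - (- r) * 1) = 2 * s * r"
      by algebra
    then show "(- s * m) * (- r * a - 0 * 1) - (- s * m) * (r * a - 0 * 1) + (s * (1 - m * a)) * (r * 1 - (- r) * 1) \<noteq> 0"
      using \<open>s \<noteq> 0\<close> \<open>r \<noteq> 0\<close> by simp
    fix x y z :: complex
    define w v Z where "w = x + y + a * z" and "v = x - y" and "Z = z - m * w"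
    have X: "- s * m * x + - s * m * y + s * (1 - m * a) * z = s * Z" unfolding Z_def w_def by algebra
    have Y: "r * x + - r * y + 0 * z = r * v" unfolding v_def by algebra
    have W: "1 * x + 1 * y + a * z = w" by (simp add: w_def)
    have m4: "4 * m = - 3 * a ^ 2 * i" by (simp add: m_def)
    have P: "4 * s * p = - 3 * a * (a ^ 3 + 8) * i" unfolding p_def using e by algebra
    have Q: "8 * q = - (a ^ 6 - 20 * a ^ 3 - 8) * i ^ 2" by (simp add: q_def)
    have 1: "4 * (x ^ 3 + y ^ 3 + z ^ 3 - 3 * a * (x * y * z))
        = 3 * v ^ 2 * w + w ^ 3 - 6 * a * w ^ 2 * z + 9 * a ^ 2 * w * z ^ 2 + 4 * k * z ^ 3"
      unfolding w_def v_def k_def by algebra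
    have z: "z = Z + m * w" by (simp add: Z_def)
    have c2: "12 * k * m + 9 * a ^ 2 = 0" using m4 k(2) by algebra
    have c1: "4 * (12 * k * m ^ 2 + 18 * a ^ 2 * m - 6 * a) = - 3 * a * (a ^ 3 + 8) * i"
      using m4 k(2) k_def by algebra
    have c0: "8 * (4 * k * m ^ 3 + 9 * a ^ 2 * m ^ 2 - 6 * a * m + 1) = - (a ^ 6 - 20 * a ^ 3 - 8) * i ^ 2"
      using m4 k(2) k_def by algebra
    show "eval_at (hesse_cubic a) (vector [x, y, z]) = 1 / 4 * eval_at (weierstrass_cubic p q)
        (vector [- s * m * x + - s * m * y + s * (1 - m * a) * z, r * x + - r * y + 0 * z, 1 * x + 1 * y + a * z])"
    proof -
      have "4 * (x ^ 3 + y ^ 3 + z ^ 3 - 3 * a * (x * y * z)) = 3 * v ^ 2 * w + 4 * k * Z ^ 3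
          + (12 * k * m + 9 * a ^ 2) * w * Z ^ 2 + (12 * k * m ^ 2 + 18 * a ^ 2 * m - 6 * a) * w ^ 2 * Z
          + (4 * k * m ^ 3 + 9 * a ^ 2 * m ^ 2 - 6 * a * m + 1) * w ^ 3"
        using 1 z by algebra
      also have "12 * k * m ^ 2 + 18 * a ^ 2 * m - 6 * a = s * p" using c1 P by algebra
      also have "4 * k * m ^ 3 + 9 * a ^ 2 * m ^ 2 - 6 * a * m + 1 = q" using c0 Q by algebra
      finally have 4: "4 * (x ^ 3 + y ^ 3 + z ^ 3 - 3 * a * (x * y * z))
          = (r * v) ^ 2 * w + (s * Z) ^ 3 + p * (s * Z) * w ^ 2 + q * w ^ 3"
        unfolding c2 power_mult_distrib r s by simp
      have "eval_at (hesse_cubic a) (vector [x, y, z]) = 1 / 4 * (4 * (x ^ 3 + y ^ 3 + z ^ 3 - 3 * a * (x * y * z)))"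
        by (simp add: hesse_cubic_eq_pencil eval_at_pencil)
      then show ?thesis
        unfolding X Y W 4 by (simp add: eval_at_weierstrass)
    qed
  qed (auto simp: weierstrass_cubic_nonzero homogeneous_weierstrass)
  ultimately show ?thesis using that by blast
qed

text \<open>
  In terms of \<open>A = a\<^sup>3\<close> the equation is a monic quartic, and \<open>A = 1\<close> is not a root of it since \<open>A(A + 8)\<^sup>3\<close>
  does not vanish there.
\<close>

lemma hesse_j_surj:
  obtains a where "a ^ 3 \<noteq> 1" "hesse_j a = v"
proof -
  have "\<not> constant (poly [:v, 512 - 3 * v, 192 + 3 * v, 24 - v, 1:])"
    by (simp add: constant_degree)
  then obtain A where A: "poly [:v, 512 - 3 * v, 192 + 3 * v, 24 - v, 1:] A = 0"
    using fundamental_theorem_of_algebra by blast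
  have e: "A * (A + 8) ^ 3 + v * (1 - A) ^ 3 = 0"
    using A by (simp add: power3_eq_cube algebra_simps)
  have "A \<noteq> 1" using e by auto
  obtain a where a: "a ^ 3 = A" by (rule complex_root_exists[of 3]) auto
  have "v * (1 - A) ^ 3 = - (A * (A + 8) ^ 3)" using e by algebra
  then have "hesse_j a = v"
    unfolding hesse_j_def a using \<open>A \<noteq> 1\<close> by (simp add: field_simps)
  then show ?thesis using that a \<open>A \<noteq> 1\<close> by blast
qed

lemma weierstrass_proj_equiv_hesse:
  assumes d: "4 * p ^ 3 + 27 * q ^ 2 \<noteq> 0" and a: "a ^ 3 \<noteq> 1"
    and j: "256 * p ^ 3 = hesse_j a * (4 * p ^ 3 + 27 * q ^ 2)"
  shows "proj_equiv (weierstrass_cubic p q) (hesse_cubic a)"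
proof -
  obtain p' q' where eq: "proj_equiv (weierstrass_cubic p' q') (hesse_cubic a)"
    and d': "4 * p' ^ 3 + 27 * q' ^ 2 \<noteq> 0" and j': "256 * p' ^ 3 = hesse_j a * (4 * p' ^ 3 + 27 * q' ^ 2)"
    using hesse_proj_equiv_weierstrass[OF a] .
  have "256 * 27 * (p ^ 3 * q' ^ 2) = 256 * 27 * (p' ^ 3 * q ^ 2)" using j j' by algebra
  then have "p ^ 3 * q' ^ 2 = p' ^ 3 * q ^ 2" by simp
  then show ?thesis using weierstrass_rescale[OF d d'] eq proj_equiv_trans by blast
qed

lemma hesse_j_eq_imp_proj_equiv:
  assumes a: "a ^ 3 \<noteq> 1" and b: "b ^ 3 \<noteq> 1" and j: "hesse_j a = hesse_j b"
  shows "proj_equiv (hesse_cubic a) (hesse_cubic b)"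
proof -
  obtain p q where eq: "proj_equiv (weierstrass_cubic p q) (hesse_cubic a)"
    and d: "4 * p ^ 3 + 27 * q ^ 2 \<noteq> 0" "256 * p ^ 3 = hesse_j a * (4 * p ^ 3 + 27 * q ^ 2)"
    using hesse_proj_equiv_weierstrass[OF a] .
  have "proj_equiv (weierstrass_cubic p q) (hesse_cubic b)"
    using d j by (intro weierstrass_proj_equiv_hesse b) simp_all
  then show ?thesis using eq proj_equiv_sym proj_equiv_trans by blast
qed

lemma weierstrass_normal_form:
  assumes d: "4 * p ^ 3 + 27 * q ^ 2 \<noteq> 0"
  obtains a where "a ^ 3 \<noteq> 1" "proj_equiv (weierstrass_cubic p q) (hesse_cubic a)"
proof -
  obtain a where a: "a ^ 3 \<noteq> 1" "hesse_j a = 256 * p ^ 3 / (4 * p ^ 3 + 27 * q ^ 2)"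
    by (rule hesse_j_surj)
  then show ?thesis
    using that weierstrass_proj_equiv_hesse[OF d a(1)] d by simp
qed

section \<open>Flexes and the reduction to Hesse form\<close>

text \<open>
  The product of \<open>r0 + r1 z + r2 z\<^sup>2\<close> over the roots \<open>z\<close> of the cubic with elementary symmetric functions
  \<open>e1, e2, e3\<close>, that is, the resultant, as a polynomial in the coefficients.
\<close>

definition norm_form :: "'a::comm_ring_1 \<Rightarrow> 'a \<Rightarrow> 'a \<Rightarrow> 'a \<Rightarrow> 'a \<Rightarrow> 'a \<Rightarrow> 'a" where
  "norm_form e1 e2 e3 r0 r1 r2 = r0 ^ 3 + r0 ^ 2 * r1 * e1 + r0 ^ 2 * r2 * (e1 ^ 2 - 2 * e2) + r0 * r1 ^ 2 * e2
     + r0 * r1 * r2 * (e1 * e2 - 3 * e3) + r0 * r2 ^ 2 * (e2 ^ 2 - 2 * e1 * e3) + r1 ^ 3 * e3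
     + r1 ^ 2 * r2 * e1 * e3 + r1 * r2 ^ 2 * e2 * e3 + r2 ^ 3 * e3 ^ 2"

lemma norm_form_factor:
  fixes z1 z2 z3 :: complex
  shows "norm_form (z1 + z2 + z3) (z1 * z2 + z1 * z3 + z2 * z3) (z1 * z2 * z3) r0 r1 r2
    = (r0 + r1 * z1 + r2 * z1 ^ 2) * (r0 + r1 * z2 + r2 * z2 ^ 2) * (r0 + r1 * z3 + r2 * z3 ^ 2)"
  unfolding norm_form_def by algebra

lemma norm_form_scale:
  fixes t :: complex
  shows "norm_form (t * e1) (t ^ 2 * e2) (t ^ 3 * e3) (t ^ 3 * r0) (t ^ 2 * r1) (t * r2)
    = t ^ 9 * norm_form e1 e2 e3 r0 r1 r2"
  unfolding norm_form_def by algebra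

lemma poly_norm_form:
  "poly (norm_form e1 e2 e3 r0 r1 r2) x
    = norm_form (poly e1 x) (poly e2 x) (poly e3 x) (poly r0 x) (poly r1 x) (poly r2 x)"
  by (simp add: norm_form_def)

lemma complex_cubic_roots:
  fixes e1 e2 e3 :: complex
  obtains z1 z2 z3 where "e1 = z1 + z2 + z3" "e2 = z1 * z2 + z1 * z3 + z2 * z3" "e3 = z1 * z2 * z3"
proof -
  have "\<not> constant (poly [:- e3, e2, - e1, 1:])" by (simp add: constant_degree)
  then obtain z1 where "poly [:- e3, e2, - e1, 1:] z1 = 0" using fundamental_theorem_of_algebra by blast
  then have z1: "z1 ^ 3 - e1 * z1 ^ 2 + e2 * z1 - e3 = 0"
    by (simp add: power2_eq_square power3_eq_cube algebra_simps)
  have "\<not> constant (poly [:e2 - z1 * (e1 - z1), - (e1 - z1), 1:])" by (simp add: constant_degree)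
  then obtain z2 where "poly [:e2 - z1 * (e1 - z1), - (e1 - z1), 1:] z2 = 0"
    using fundamental_theorem_of_algebra by blast
  then have z2: "z2 ^ 2 - (e1 - z1) * z2 + (e2 - z1 * (e1 - z1)) = 0"
    by (simp add: power2_eq_square algebra_simps)
  show ?thesis
  proof (rule that[of z1 z2 "e1 - z1 - z2"])
    show "e2 = z1 * z2 + z1 * (e1 - z1 - z2) + z2 * (e1 - z1 - z2)" using z2 by algebra
    show "e3 = z1 * z2 * (e1 - z1 - z2)" using z1 z2 by algebra
  qed simp
qed

definition bin1 :: "complex \<Rightarrow> complex \<Rightarrow> complex \<Rightarrow> complex \<Rightarrow> complex" where
  "bin1 a b x y = a * x + b * y"
definition bin2 :: "complex \<Rightarrow> complex \<Rightarrow> complex \<Rightarrow> complex \<Rightarrow> complex \<Rightarrow> complex" where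
  "bin2 a b c x y = a * x ^ 2 + b * x * y + c * y ^ 2"
definition bin3 :: "complex \<Rightarrow> complex \<Rightarrow> complex \<Rightarrow> complex \<Rightarrow> complex \<Rightarrow> complex \<Rightarrow> complex" where
  "bin3 a b c d x y = a * x ^ 3 + b * x ^ 2 * y + c * x * y ^ 2 + d * y ^ 3"

text \<open>
  With coefficients that are binary forms of the matching degrees, the norm is a binary form of
  degree nine. Dehomogenised at \<open>y = 1\<close> it has a root unless it is constant, and then it is a
  multiple of \<open>y\<^sup>9\<close>, which vanishes at \<open>(1, 0)\<close>.
\<close>

lemma norm_form_binary_zero:
  obtains x y where "x \<noteq> 0 \<or> y \<noteq> 0"
    "norm_form (bin1 a1 a2 x y) (bin2 b1 b2 b3 x y) (bin3 c1 c2 c3 c4 x y)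
       (bin3 d1 d2 d3 d4 x y) (bin2 f1 f2 f3 x y) (bin1 g1 g2 x y) = 0"
proof -
  define N where "N x y = norm_form (bin1 a1 a2 x y) (bin2 b1 b2 b3 x y) (bin3 c1 c2 c3 c4 x y)
       (bin3 d1 d2 d3 d4 x y) (bin2 f1 f2 f3 x y) (bin1 g1 g2 x y)" for x y
  define P where "P = norm_form [:a2, a1:] [:b3, b2, b1:] [:c4, c3, c2, c1:] [:d4, d3, d2, d1:] [:f3, f2, f1:] [:g2, g1:]"
  define Q where "Q = norm_form [:a1, a2:] [:b1, b2, b3:] [:c1, c2, c3, c4:] [:d1, d2, d3, d4:] [:f1, f2, f3:] [:g1, g2:]"
  note bin = bin1_def bin2_def bin3_def
  have P: "poly P x = N x 1" for x
    unfolding P_def N_def poly_norm_form by (simp add: bin power2_eq_square power3_eq_cube algebra_simps)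
  have Q: "poly Q y = N 1 y" for y
    unfolding Q_def N_def poly_norm_form by (simp add: bin power2_eq_square power3_eq_cube algebra_simps)
  have scale: "N (t * x) (t * y) = t ^ 9 * N x y" for t x y
  proof -
    have b: "bin1 a b (t * x) (t * y) = t * bin1 a b x y" "bin2 a b c (t * x) (t * y) = t ^ 2 * bin2 a b c x y"
      "bin3 a b c d (t * x) (t * y) = t ^ 3 * bin3 a b c d x y" for a b c d
      unfolding bin by algebra+
    show ?thesis unfolding N_def b by (rule norm_form_scale)
  qed
  show ?thesis
  proof (cases "constant (poly P)")
    case False
    then obtain x where "poly P x = 0" using fundamental_theorem_of_algebra by blast
    then show ?thesis using that[of x 1] P by (simp add: N_def)
  next
    case True
    then obtain c where c: "\<And>x. N x 1 = c" unfolding constant_def P by metis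
    \<comment> \<open>The factor \<open>y\<close> avoids dividing by zero at the origin.\<close>
    have "poly ([:0, 1:] * (Q - monom c 9)) y = 0" for y
    proof (cases "y = 0")
      case False
      then have "N 1 y = y ^ 9 * N (1 / y) 1" using scale[of y "1 / y" 1] by simp
      then show ?thesis by (simp add: Q c poly_monom)
    qed simp
    then have "[:0, 1:] * (Q - monom c 9) = 0" by (simp only: poly_all_0_iff_0[symmetric]) simp
    then have "Q = monom c 9" by (simp del: mult_pCons_left)
    then have "N 1 0 = 0" using Q[of 0] by (simp add: poly_monom)
    then show ?thesis using that[of 1 0] by (simp add: N_def)
  qed
qed

text \<open>
  A special case of Bezout's theorem. As \<open>f\<close> is nonzero at \<open>(0, 0, 1)\<close>, it is a cubic polynomial
  in \<open>z\<close> with constant leading coefficient. The remainder of \<open>h\<close> modulo \<open>f\<close> is quadratic in \<open>z\<close>, and a zero \<open>(x, y)\<close> of its norm is a place where it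
  shares a root with \<open>f\<close>.
\<close>

lemma homogeneous_3_common_zero_off_point:
  assumes f: "homogeneous 3 f" and h: "homogeneous 3 h" and f3: "eval_at f (vector [0, 0, 1]) \<noteq> 0"
  shows "\<exists>v. v \<noteq> 0 \<and> eval_at f v = 0 \<and> eval_at h v = 0"
proof -
  obtain a1 a2 a3 a4 a5 a6 a7 a8 a9 a10 where f_eq:
   "f = Const a1 * Var 1 ^ 3 + Const a2 * Var 2 ^ 3 + Const a3 * Var 3 ^ 3
      + Const a4 * Var 1 ^ 2 * Var 2 + Const a5 * Var 1 ^ 2 * Var 3
      + Const a6 * Var 2 ^ 2 * Var 1 + Const a7 * Var 2 ^ 2 * Var 3
      + Const a8 * Var 3 ^ 2 * Var 1 + Const a9 * Var 3 ^ 2 * Var 2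
      + Const a10 * Var 1 * Var 2 * Var 3"
    by (rule homogeneous_3_expand[OF f])
  obtain h1 h2 h3 h4 h5 h6 h7 h8 h9 h10 where h_eq:
   "h = Const h1 * Var 1 ^ 3 + Const h2 * Var 2 ^ 3 + Const h3 * Var 3 ^ 3
      + Const h4 * Var 1 ^ 2 * Var 2 + Const h5 * Var 1 ^ 2 * Var 3
      + Const h6 * Var 2 ^ 2 * Var 1 + Const h7 * Var 2 ^ 2 * Var 3
      + Const h8 * Var 3 ^ 2 * Var 1 + Const h9 * Var 3 ^ 2 * Var 2
      + Const h10 * Var 1 * Var 2 * Var 3"
    by (rule homogeneous_3_expand[OF h])
  have "a3 \<noteq> 0" using f3 by (simp add: f_eq)
  define i k where "i = inverse a3" and "k = h3 * i"
  have i: "a3 * i = 1" using \<open>a3 \<noteq> 0\<close> by (simp add: i_def)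
  have k: "h3 = k * a3" using i by (simp add: k_def mult.assoc mult.commute)
  obtain x y where xy: "x \<noteq> 0 \<or> y \<noteq> 0"
    and N: "norm_form (bin1 (- i * a8) (- i * a9) x y) (bin2 (i * a5) (i * a10) (i * a7) x y)
      (bin3 (- i * a1) (- i * a4) (- i * a6) (- i * a2) x y)
       (bin3 (h1 - k * a1) (h4 - k * a4) (h6 - k * a6) (h2 - k * a2) x y)
       (bin2 (h5 - k * a5) (h10 - k * a10) (h7 - k * a7) x y) (bin1 (h8 - k * a8) (h9 - k * a9) x y) = 0"
    by (rule norm_form_binary_zero)
  define r0 r1 r2 where "r0 = bin3 (h1 - k * a1) (h4 - k * a4) (h6 - k * a6) (h2 - k * a2) x y"
    and "r1 = bin2 (h5 - k * a5) (h10 - k * a10) (h7 - k * a7) x y" and "r2 = bin1 (h8 - k * a8) (h9 - k * a9) x y"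
  obtain z1 z2 z3 where e1: "bin1 (- i * a8) (- i * a9) x y = z1 + z2 + z3"
    and e2: "bin2 (i * a5) (i * a10) (i * a7) x y = z1 * z2 + z1 * z3 + z2 * z3"
    and e3: "bin3 (- i * a1) (- i * a4) (- i * a6) (- i * a2) x y = z1 * z2 * z3"
    by (rule complex_cubic_roots)
  have "(r0 + r1 * z1 + r2 * z1 ^ 2) * (r0 + r1 * z2 + r2 * z2 ^ 2) * (r0 + r1 * z3 + r2 * z3 ^ 2) = 0"
    using N unfolding e1 e2 e3 norm_form_factor r0_def r1_def r2_def .
  then obtain z where z: "z = z1 \<or> z = z2 \<or> z = z3" and r: "r0 + r1 * z + r2 * z ^ 2 = 0" by auto
  have e: "a8 * x + a9 * y = - a3 * (z1 + z2 + z3)"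
    "a5 * x ^ 2 + a10 * x * y + a7 * y ^ 2 = a3 * (z1 * z2 + z1 * z3 + z2 * z3)"
    "a1 * x ^ 3 + a4 * x ^ 2 * y + a6 * x * y ^ 2 + a2 * y ^ 3 = - a3 * (z1 * z2 * z3)"
    unfolding e1[symmetric] e2[symmetric] e3[symmetric] bin1_def bin2_def bin3_def using i by algebra+
  let ?v = "vector [x, y, z] :: complex ^ 3"
  have fv: "eval_at f ?v = a3 * z ^ 3 + (a8 * x + a9 * y) * z ^ 2
      + (a5 * x ^ 2 + a10 * x * y + a7 * y ^ 2) * z + (a1 * x ^ 3 + a4 * x ^ 2 * y + a6 * x * y ^ 2 + a2 * y ^ 3)"
    by (simp add: f_eq algebra_simps)
  also have "\<dots> = a3 * ((z - z1) * (z - z2) * (z - z3))" unfolding e by algebra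
  finally have f0: "eval_at f ?v = 0" using z by auto
  have "eval_at h ?v = k * eval_at f ?v + (r0 + r1 * z + r2 * z ^ 2)"
    unfolding r0_def r1_def r2_def bin1_def bin2_def bin3_def
    by (simp add: f_eq h_eq k algebra_simps)
  then have "eval_at h ?v = 0" using f0 r by simp
  moreover have "?v \<noteq> 0" using xy by (auto simp: vec_eq_iff forall_3)
  ultimately show ?thesis using f0 by blast
qed

lemma homogeneous_3_common_zero:
  assumes "homogeneous 3 f" "homogeneous 3 h"
  obtains v where "v \<noteq> 0" "eval_at f v = 0" "eval_at h v = 0"
proof -
  have "(vector [0, 0, 1] :: complex ^ 3) \<noteq> 0" by (simp add: vec_eq_iff forall_3)
  then show ?thesis
    using that homogeneous_3_common_zero_off_point[OF assms] homogeneous_3_common_zero_off_point[OF assms(2,1)] by blast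
qed

lemma homogeneous_Hess:
  assumes "homogeneous 3 f"
  shows "homogeneous 3 (Hess f)"
proof -
  have "homogeneous 2 (pdiff i f)" for i
    using homogeneous_pdiff[of 2 f i] assms by simp
  then have 1: "homogeneous 1 (pdiff i (pdiff j f))" for i j
    using homogeneous_pdiff[of 1 "pdiff j f" i] by (simp add: numeral_2_eq_2)
  have "homogeneous (1 + 1 + 1) (pdiff i (pdiff j f) * pdiff k (pdiff l f) * pdiff m (pdiff n f))" for i j k l m n
    by (intro homogeneous_mult 1)
  then have "homogeneous 3 (pdiff i (pdiff j f) * pdiff k (pdiff l f) * pdiff m (pdiff n f))" for i j k l m n
    by (simp add: numeral_3_eq_3)
  then show ?thesis unfolding Hess_def det_3 by (simp add: homogeneous_add homogeneous_diff)
qed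

lemma move_point:
  assumes "v \<noteq> (0 :: complex ^ 3)"
  obtains B :: "complex ^ 3 ^ 3" where "invertible B" "B *v vector [0, 1, 0] = v"
proof -
  have mv: "vector [vector [a, v $ 1, b], vector [c, v $ 2, d], vector [e, v $ 3, f]]
      *v (vector [0, 1, 0] :: complex ^ 3) = v"
    for a b c d e f :: complex
    by (simp add: vec_eq_iff forall_3 matrix_vector_mult_def sum_3)
  consider "v $ 1 \<noteq> 0" | "v $ 2 \<noteq> 0" | "v $ 3 \<noteq> 0" using assms by (auto simp: vec_eq_iff forall_3)
  then show ?thesis
  proof cases
    case 1 show ?thesis by (rule that[OF invertible_matrix_3[OF refl] mv[of 0 0 1 0 0 1]]) (use 1 in simp)
  next
    case 2 show ?thesis by (rule that[OF invertible_matrix_3[OF refl] mv[of 1 0 0 0 0 1]]) (use 2 in simp)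
  next
    case 3 show ?thesis by (rule that[OF invertible_matrix_3[OF refl] mv[of 1 0 0 1 0 0]]) (use 3 in simp)
  qed
qed

text \<open>
  The general cubic form without the terms \<open>y\<^sup>3\<close>, \<open>xy\<^sup>2\<close> and \<open>x\<^sup>2y\<close>. When \<open>b1\<close> is nonzero, the curve is
  smooth at \<open>(0 : 1 : 0)\<close> and meets its tangent \<open>z = 0\<close> there with multiplicity at least three.
\<close>

definition flex_cubic :: "complex \<Rightarrow> complex \<Rightarrow> complex \<Rightarrow> complex \<Rightarrow> complex \<Rightarrow> complex \<Rightarrow> complex \<Rightarrow> tpoly" where
  "flex_cubic b1 b2 b3 b4 b5 b6 b7 = Const b1 * (Var 2 ^ 2 * Var 3) + Const b2 * (Var 1 * Var 2 * Var 3)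
     + Const b3 * (Var 2 * Var 3 ^ 2) + Const b4 * Var 1 ^ 3 + Const b5 * (Var 1 ^ 2 * Var 3)
     + Const b6 * (Var 1 * Var 3 ^ 2) + Const b7 * Var 3 ^ 3"

text \<open>
  A common zero of the cubic and its Hessian is moved to \<open>(0 : 1 : 0)\<close>. The tangent there is then made
  \<open>z = 0\<close>, by exchanging \<open>x\<close> and \<open>z\<close> or by a shear; vanishing of the Hessian says that the
  coefficient of \<open>x\<^sup>2y\<close> vanishes in the new coordinates.
\<close>

lemma smooth_cubic_proj_equiv_flex_cubic:
  assumes f: "smooth_cubic f"
  obtains b1 b2 b3 b4 b5 b6 b7 where "b1 \<noteq> 0" "proj_equiv f (flex_cubic b1 b2 b3 b4 b5 b6 b7)"
proof -
  have f3: "homogeneous 3 f" "f \<noteq> 0" using f by (simp_all add: smooth_cubic_def)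
  obtain v where v: "v \<noteq> 0" "eval_at f v = 0" "eval_at (Hess f) v = 0"
    using homogeneous_3_common_zero[OF f3(1) homogeneous_Hess[OF f3(1)]] .
  obtain B :: "complex ^ 3 ^ 3" where B: "invertible B" "B *v vector [0, 1, 0] = v" using move_point[OF v(1)] .
  define g where "g = lin_subst B f"
  have fg: "proj_equiv f g"
    using f3 B(1) by (intro proj_equivI[where B = B and c = 1]) (auto simp: g_def)
  have g: "smooth_cubic g" using smooth_cubic_proj_equiv[OF f fg] .
  then have g3: "homogeneous 3 g" "g \<noteq> 0" by (simp_all add: smooth_cubic_def)
  let ?e = "vector [0, 1, 0] :: complex ^ 3"
  have g0: "eval_at g ?e = 0" "eval_at (Hess g) ?e = 0"
    using v by (simp_all add: g_def Hess_lin_subst eval_at_lin_subst B)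
  have "?e \<noteq> 0" by (simp add: vec_eq_iff forall_3)
  then have "\<exists>i. eval_at (pdiff i g) ?e \<noteq> 0" using g g0 unfolding smooth_cubic_def by blast
  then have gr: "eval_at (pdiff 1 g) ?e \<noteq> 0 \<or> eval_at (pdiff 2 g) ?e \<noteq> 0 \<or> eval_at (pdiff 3 g) ?e \<noteq> 0"
    by (metis exhaust_3)
  obtain a1 a2 a3 a4 a5 a6 a7 a8 a9 a10 where g_eq:
   "g = Const a1 * Var 1 ^ 3 + Const a2 * Var 2 ^ 3 + Const a3 * Var 3 ^ 3
      + Const a4 * Var 1 ^ 2 * Var 2 + Const a5 * Var 1 ^ 2 * Var 3
      + Const a6 * Var 2 ^ 2 * Var 1 + Const a7 * Var 2 ^ 2 * Var 3
      + Const a8 * Var 3 ^ 2 * Var 1 + Const a9 * Var 3 ^ 2 * Var 2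
      + Const a10 * Var 1 * Var 2 * Var 3"
    by (rule homogeneous_3_expand[OF g3(1)])
  have a2: "a2 = 0" using g0(1) by (simp add: g_eq)
  have tangent: "a6 \<noteq> 0 \<or> a7 \<noteq> 0" using gr by (simp add: g_eq a2)
  have "8 * (a4 * a7 ^ 2 - a6 * a7 * a10 + a6 ^ 2 * a9) = 0"
    using g0(2) by (simp add: Hess_def det_3 g_eq a2) algebra
  then have hess: "a4 * a7 ^ 2 - a6 * a7 * a10 + a6 ^ 2 * a9 = 0" unfolding mult_eq_0_iff by simp
  show ?thesis
  proof (cases "a7 = 0")
    case True
    then have "a6 \<noteq> 0" "a9 = 0" using tangent hess by auto
    have "proj_equiv g (flex_cubic a6 a10 a4 a3 a8 a5 a1)"
      by (rule proj_equiv_substI[where d = 3 and c = 1 and ?b11.0 = 0 and ?b12.0 = 0 and ?b13.0 = 1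
        and ?b21.0 = 0 and ?b22.0 = 1 and ?b23.0 = 0 and ?b31.0 = 1 and ?b32.0 = 0 and ?b33.0 = 0])
        (use g3 in \<open>auto simp: flex_cubic_def g_eq a2 True \<open>a9 = 0\<close>\<close>)
    then show ?thesis using that \<open>a6 \<noteq> 0\<close> fg proj_equiv_trans by blast
  next
    case False
    define t where "t = - a6 / a7"
    have t: "a6 = - t * a7" using False by (simp add: t_def)
    have "a7 ^ 2 * (a4 + a10 * t + a9 * t ^ 2) = 0" using hess unfolding t by algebra
    then have a4: "a4 + a10 * t + a9 * t ^ 2 = 0" using False by simp
    have "proj_equiv g (flex_cubic a7 (a10 + 2 * a9 * t) a9 (a1 + a5 * t + a8 * t ^ 2 + a3 * t ^ 3)
      (a5 + 2 * a8 * t + 3 * a3 * t ^ 2) (a8 + 3 * a3 * t) a3)"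
    proof (rule proj_equiv_substI[where d = 3 and c = 1 and ?b11.0 = 1 and ?b12.0 = 0 and ?b13.0 = 0
        and ?b21.0 = 0 and ?b22.0 = 1 and ?b23.0 = 0 and ?b31.0 = t and ?b32.0 = 0 and ?b33.0 = 1])
      fix x y z :: complex
      have "a1 * x ^ 3 + a3 * (t * x + z) ^ 3 + a4 * x ^ 2 * y + a5 * x ^ 2 * (t * x + z)
         + a6 * y ^ 2 * x + a7 * y ^ 2 * (t * x + z) + a8 * (t * x + z) ^ 2 * x + a9 * (t * x + z) ^ 2 * y
         + a10 * x * y * (t * x + z)
        = a7 * (y ^ 2 * z) + (a10 + 2 * a9 * t) * (x * y * z) + a9 * (y * z ^ 2)
          + (a1 + a5 * t + a8 * t ^ 2 + a3 * t ^ 3) * x ^ 3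
          + (a5 + 2 * a8 * t + 3 * a3 * t ^ 2) * (x ^ 2 * z) + (a8 + 3 * a3 * t) * (x * z ^ 2) + a3 * z ^ 3"
        using t a4 by algebra
      then show "eval_at (flex_cubic a7 (a10 + 2 * a9 * t) a9 (a1 + a5 * t + a8 * t ^ 2 + a3 * t ^ 3)
        (a5 + 2 * a8 * t + 3 * a3 * t ^ 2) (a8 + 3 * a3 * t) a3) (vector [x, y, z])
        = 1 * eval_at g (vector [1 * x + 0 * y + 0 * z, 0 * x + 1 * y + 0 * z, t * x + 0 * y + 1 * z])"
        by (simp add: flex_cubic_def g_eq a2)
    qed (use g3 in auto)
    then show ?thesis using that False fg proj_equiv_trans by blast
  qed
qed

text \<open>
  Otherwise \<open>z\<close> divides the cubic, and the curve is singular where the line \<open>z = 0\<close> meets the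
  residual conic.
\<close>

lemma smooth_flex_cubic_nonzero:
  assumes s: "smooth_cubic (flex_cubic b1 b2 b3 b4 b5 b6 b7)" and b1: "b1 \<noteq> 0"
  shows "b4 \<noteq> 0"
proof
  assume b4: "b4 = 0"
  have "\<not> constant (poly [:b5, b2, b1:])" using b1 by (simp add: constant_degree)
  then obtain y where "poly [:b5, b2, b1:] y = 0" using fundamental_theorem_of_algebra by blast
  then have y: "b1 * y ^ 2 + b2 * y + b5 = 0" by (simp add: power2_eq_square algebra_simps)
  let ?v = "vector [1, y, 0] :: complex ^ 3" and ?f = "flex_cubic b1 b2 b3 b4 b5 b6 b7"
  have "?v \<noteq> 0" by (simp add: vec_eq_iff forall_3)
  moreover have "eval_at ?f ?v = 0" by (simp add: flex_cubic_def b4)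
  ultimately obtain i where i: "eval_at (pdiff i ?f) ?v \<noteq> 0" using s unfolding smooth_cubic_def by blast
  have "eval_at (pdiff 1 ?f) ?v = 0" "eval_at (pdiff 2 ?f) ?v = 0" "eval_at (pdiff 3 ?f) ?v = 0"
    using y by (simp_all add: flex_cubic_def b4)
  then show False using i exhaust_3[of i] by auto
qed

text \<open>
  Completing the square in \<open>y\<close> and the cube in \<open>x\<close>.
\<close>

lemma weierstrass_proj_equiv_flex_cubic:
  assumes "b1 \<noteq> 0" "b4 \<noteq> 0"
  obtains p q where "proj_equiv (weierstrass_cubic p q) (flex_cubic b1 b2 b3 b4 b5 b6 b7)"
proof -
  obtain r where r: "r ^ 2 = b1" by (rule complex_root_exists[of 2]) auto
  obtain s where s: "s ^ 3 = b4" by (rule complex_root_exists[of 3]) auto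
  have "r \<noteq> 0" "s \<noteq> 0" using r s assms by auto
  define l m B5 B6 B7 where "l = b2 / (2 * b1)" and "m = b3 / (2 * b1)"
    and "B5 = b5 - b1 * l ^ 2" and "B6 = b6 - 2 * b1 * l * m" and "B7 = b7 - b1 * m ^ 2"
  have lm: "b2 = 2 * b1 * l" "b3 = 2 * b1 * m" using assms by (simp_all add: l_def m_def)
  define k where "k = B5 / (3 * b4)"
  have k: "B5 = 3 * b4 * k" using assms by (simp add: k_def)
  define p where "p = (B6 - 3 * b4 * k ^ 2) / s"
  have p: "s * p = B6 - 3 * b4 * k ^ 2" using \<open>s \<noteq> 0\<close> by (simp add: p_def)
  define q where "q = B7 - b4 * k ^ 3 - s * p * k"
  have b567: "b5 = 3 * b4 * k + b1 * l ^ 2" "b6 = s * p + 3 * b4 * k ^ 2 + 2 * b1 * l * m"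
    "b7 = q + b4 * k ^ 3 + s * p * k + b1 * m ^ 2"
    using B5_def k B6_def p B7_def q_def by algebra+
  have "proj_equiv (weierstrass_cubic p q) (flex_cubic b1 b2 b3 b4 b5 b6 b7)"
  proof (rule proj_equiv_substI[where d = 3 and c = 1 and ?b11.0 = s and ?b12.0 = 0 and ?b13.0 = "s * k"
        and ?b21.0 = "r * l" and ?b22.0 = r and ?b23.0 = "r * m" and ?b31.0 = 0 and ?b32.0 = 0 and ?b33.0 = 1])
    fix x y z :: complex
    have "b1 * (y ^ 2 * z) + b2 * (x * y * z) + b3 * (y * z ^ 2) + b4 * x ^ 3 + b5 * (x ^ 2 * z) + b6 * (x * z ^ 2) + b7 * z ^ 3
      = (r * l * x + r * y + r * m * z) ^ 2 * z + (s * x + s * k * z) ^ 3 + p * (s * x + s * k * z) * z ^ 2 + q * z ^ 3"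
      unfolding lm b567 r[symmetric] s[symmetric] by algebra
    then show "eval_at (flex_cubic b1 b2 b3 b4 b5 b6 b7) (vector [x, y, z]) = 1 * eval_at (weierstrass_cubic p q)
       (vector [s * x + 0 * y + s * k * z, r * l * x + r * y + r * m * z, 0 * x + 0 * y + 1 * z])"
      by (simp add: flex_cubic_def eval_at_weierstrass)
  qed (use \<open>r \<noteq> 0\<close> \<open>s \<noteq> 0\<close> in \<open>auto simp: weierstrass_cubic_nonzero homogeneous_weierstrass\<close>)
  then show ?thesis by (rule that)
qed

text \<open>
  A double root \<open>x\<close> of the cubic polynomial \<open>x\<^sup>3 + px + q\<close> gives the singular point \<open>(x : 0 : 1)\<close>.
\<close>

lemma smooth_weierstrass_discriminant:
  assumes s: "smooth_cubic (weierstrass_cubic p q)"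
  shows "4 * p ^ 3 + 27 * q ^ 2 \<noteq> 0"
proof
  assume d: "4 * p ^ 3 + 27 * q ^ 2 = 0"
  obtain x where x: "3 * x ^ 2 + p = 0" "2 * p * x + 3 * q = 0" "x ^ 3 + p * x + q = 0"
  proof (cases "p = 0")
    case True
    then show ?thesis using that[of 0] d by simp
  next
    case False
    define x where "x = - 3 * q / (2 * p)"
    have x: "2 * p * x = - 3 * q" using False by (simp add: x_def)
    have "4 * p ^ 2 * (3 * x ^ 2 + p) = 0" using x d by algebra
    then have 1: "3 * x ^ 2 + p = 0" using False by simp
    have "3 * (x ^ 3 + p * x + q) = 0" using x 1 by algebra
    then have "x ^ 3 + p * x + q = 0" unfolding mult_eq_0_iff by simp
    then show ?thesis using that[of x] x 1 by simp
  qed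
  let ?v = "vector [x, 0, 1] :: complex ^ 3" and ?f = "weierstrass_cubic p q"
  have "?v \<noteq> 0" by (simp add: vec_eq_iff forall_3)
  moreover have "eval_at ?f ?v = 0" using x by (simp add: weierstrass_cubic_def)
  ultimately obtain i where i: "eval_at (pdiff i ?f) ?v \<noteq> 0" using s unfolding smooth_cubic_def by blast
  have "eval_at (pdiff 1 ?f) ?v = 0" "eval_at (pdiff 2 ?f) ?v = 0" "eval_at (pdiff 3 ?f) ?v = 0"
    using x by (simp_all add: weierstrass_cubic_def ac_simps)
  then show False using i exhaust_3[of i] by auto
qed

theorem hesse_normal_form_exists:
  assumes f: "smooth_cubic f"
  obtains a where "a ^ 3 \<noteq> 1" "proj_equiv f (hesse_cubic a)"
proof -
  obtain b1 b2 b3 b4 b5 b6 b7 where b1: "b1 \<noteq> 0" and eq: "proj_equiv f (flex_cubic b1 b2 b3 b4 b5 b6 b7)"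
    using smooth_cubic_proj_equiv_flex_cubic[OF f] .
  have s: "smooth_cubic (flex_cubic b1 b2 b3 b4 b5 b6 b7)" using smooth_cubic_proj_equiv[OF f eq] .
  obtain p q where W: "proj_equiv (weierstrass_cubic p q) (flex_cubic b1 b2 b3 b4 b5 b6 b7)"
    using weierstrass_proj_equiv_flex_cubic[OF b1 smooth_flex_cubic_nonzero[OF s b1]] .
  have "smooth_cubic (weierstrass_cubic p q)" using smooth_cubic_proj_equiv[OF s proj_equiv_sym[OF W]] .
  then obtain a where "a ^ 3 \<noteq> 1" "proj_equiv (weierstrass_cubic p q) (hesse_cubic a)"
    using weierstrass_normal_form[OF smooth_weierstrass_discriminant] by blast
  then show ?thesis using that eq W proj_equiv_sym proj_equiv_trans by blast
qed

section \<open>Comparing the Macaulay and the Hessian polynomial\<close>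

lemma j_inv_eq_hesse_j:
  assumes "proj_equiv f (hesse_cubic a)" "a ^ 3 \<noteq> 1"
  shows "j_inv f = hesse_j a"
  unfolding j_inv_def hesse_j_def[symmetric]
proof (rule the_equality)
  show "\<exists>b. b ^ 3 \<noteq> 1 \<and> proj_equiv f (hesse_cubic b) \<and> hesse_j a = hesse_j b" using assms by blast
  fix v assume "\<exists>b. b ^ 3 \<noteq> 1 \<and> proj_equiv f (hesse_cubic b) \<and> v = hesse_j b"
  then obtain b where b: "b ^ 3 \<noteq> 1" "proj_equiv f (hesse_cubic b)" "v = hesse_j b" by blast
  then show "v = hesse_j a"
    using hesse_j_proj_invariant[of b a] assms proj_equiv_sym proj_equiv_trans by blast
qed

lemma proj_equiv_iff_j_inv_eq:
  assumes "smooth_cubic f" "smooth_cubic g"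
  shows "proj_equiv f g \<longleftrightarrow> j_inv f = j_inv g"
proof -
  obtain a where a: "a ^ 3 \<noteq> 1" "proj_equiv f (hesse_cubic a)" by (rule hesse_normal_form_exists[OF assms(1)])
  obtain b where b: "b ^ 3 \<noteq> 1" "proj_equiv g (hesse_cubic b)" by (rule hesse_normal_form_exists[OF assms(2)])
  have "proj_equiv f g \<longleftrightarrow> proj_equiv (hesse_cubic a) (hesse_cubic b)"
    using a(2) b(2) proj_equiv_sym proj_equiv_trans by meson
  also have "\<dots> \<longleftrightarrow> hesse_j a = hesse_j b"
    using hesse_j_proj_invariant hesse_j_eq_imp_proj_equiv a(1) b(1) by blast
  finally show ?thesis by (simp add: j_inv_eq_hesse_j[OF a(2,1)] j_inv_eq_hesse_j[OF b(2,1)])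
qed

lemma hesse_j_mult: "a ^ 3 \<noteq> 1 \<Longrightarrow> hesse_j a * (1 - a ^ 3) ^ 3 = - (a ^ 3 * (a ^ 3 + 8) ^ 3)"
  by (simp add: hesse_j_def)

text \<open>
  The parameters \<open>c\<close> and \<open>b\<close> are those of the Hesse cubics proportional to the Macaulay polynomial and
  to the Hessian of \<open>f\<^sub>a\<close>. In terms of \<open>A = a\<^sup>3\<close> and \<open>J = j(f\<^sub>a)\<close> the two values of \<open>j\<close> come from
  clearing denominators in \<open>c\<^sup>3 = -8 / A\<close> and \<open>b\<^sup>3 = (4 - A)\<^sup>3 / (27 A\<^sup>2)\<close>; for \<open>b\<close> the key identity is
  \<open>(4 - A)((4 - A)\<^sup>3 + 216 A\<^sup>2) = (256 - J)(1 - A)\<^sup>3\<close>.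
\<close>

lemma hesse_j_Mac_Hess:
  assumes a: "a ^ 3 \<noteq> 1" and J: "hesse_j a \<noteq> 0"
  defines "c \<equiv> - 2 / a" and "b \<equiv> (4 - a ^ 3) / (3 * a ^ 2)"
  shows "c ^ 3 \<noteq> 1" "b ^ 3 \<noteq> 1" "hesse_j c * hesse_j a = 4096"
    "hesse_j b * (27 * hesse_j a ^ 2) = (256 - hesse_j a) ^ 3"
proof -
  define A k j where "A = a ^ 3" and "k = 1 - A" and "j = hesse_j a"
  have j: "j * k ^ 3 = - (A * (A + 8) ^ 3)" using hesse_j_mult[OF a] by (simp add: A_def k_def j_def)
  have nz: "k \<noteq> 0" "j \<noteq> 0" "A \<noteq> 0" "A + 8 \<noteq> 0"
    using a J j by (auto simp: A_def k_def j_def)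
  have "a \<noteq> 0" using nz by (auto simp: A_def)
  have C: "A * c ^ 3 = - 8"
    using \<open>a \<noteq> 0\<close> by (simp add: A_def c_def power_divide)
  have B: "27 * A ^ 2 * b ^ 3 = (4 - A) ^ 3"
    using \<open>a \<noteq> 0\<close> by (simp add: A_def b_def power_divide power_mult_distrib flip: power_mult)
  show c: "c ^ 3 \<noteq> 1" using C nz by (metis add.left_inverse mult.right_neutral neg_equal_iff_equal)
  have B1: "27 * A ^ 2 * (1 - b ^ 3) = - k * (A + 8) ^ 2"
    using B unfolding k_def by algebra
  then show b: "b ^ 3 \<noteq> 1" using nz by auto
  have jc: "hesse_j c * (1 - c ^ 3) ^ 3 = - (c ^ 3 * (c ^ 3 + 8) ^ 3)" by (rule hesse_j_mult[OF c])
  have C1: "A * (1 - c ^ 3) = A + 8" "A * (c ^ 3 + 8) = - 8 * k" using C unfolding k_def by algebra+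
  have "hesse_j c * (A * (1 - c ^ 3)) ^ 3 * A = - ((A * c ^ 3) * (A * (c ^ 3 + 8)) ^ 3)"
    using jc by algebra
  then have "hesse_j c * (A + 8) ^ 3 * A = - 4096 * k ^ 3"
    unfolding C C1 by (simp add: power_mult_distrib)
  then have "(hesse_j c * j) * k ^ 3 = 4096 * k ^ 3" using j by algebra
  then show "hesse_j c * hesse_j a = 4096" using nz by (simp add: j_def)
  have jb: "hesse_j b * (1 - b ^ 3) ^ 3 = - (b ^ 3 * (b ^ 3 + 8) ^ 3)" by (rule hesse_j_mult[OF b])
  have B8: "27 * A ^ 2 * (b ^ 3 + 8) = (4 - A) ^ 3 + 216 * A ^ 2" using B by algebra
  have "hesse_j b * (27 * A ^ 2 * (1 - b ^ 3)) ^ 3 * (27 * A ^ 2)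
      = - ((27 * A ^ 2 * b ^ 3) * (27 * A ^ 2 * (b ^ 3 + 8)) ^ 3)"
    using jb by algebra
  then have 1: "hesse_j b * (- k * (A + 8) ^ 2) ^ 3 * (27 * A ^ 2)
      = - (((4 - A) * ((4 - A) ^ 3 + 216 * A ^ 2)) ^ 3)"
    unfolding B1 B B8 power_mult_distrib by simp
  have "(4 - A) * ((4 - A) ^ 3 + 216 * A ^ 2) = A * (A + 8) ^ 3 + 256 * k ^ 3"
    unfolding k_def by algebra
  also have "\<dots> = (256 - j) * k ^ 3" using j by algebra
  finally have 2: "(4 - A) * ((4 - A) ^ 3 + 216 * A ^ 2) = (256 - j) * k ^ 3" .
  have "hesse_j b * (- k * (A + 8) ^ 2) ^ 3 * (27 * A ^ 2) = - (hesse_j b * (27 * (A * (A + 8) ^ 3) ^ 2)) * k ^ 3"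
    by algebra
  also have "A * (A + 8) ^ 3 = - (j * k ^ 3)" using j by simp
  finally have "(hesse_j b * (27 * j ^ 2)) * k ^ 9 = (256 - j) ^ 3 * k ^ 9"
    using 1 unfolding 2 by algebra
  then show "hesse_j b * (27 * hesse_j a ^ 2) = (256 - hesse_j a) ^ 3" using nz by (simp add: j_def)
qed

lemma j_omega_roots: "(z - j_omega) * (z - cnj j_omega) = z ^ 2 - 704 * z + 262144"
proof -
  define s where "s = complex_of_real (sqrt 15)"
  have s: "s ^ 2 = 15" unfolding s_def of_real_power[symmetric] by simp
  have "cnj s = s" by (simp add: s_def)
  then have "(z - j_omega) * (z - cnj j_omega) = (z - (352 + 96 * s * \<i>)) * (z - (352 - 96 * s * \<i>))"
    unfolding j_omega_def s_def[symmetric] by simp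
  also have "\<dots> = z ^ 2 - 704 * z + 123904 - 9216 * (s ^ 2 * (\<i> * \<i>))"
    by (simp only: power2_eq_square) (simp add: algebra_simps)
  also have "\<dots> = z ^ 2 - 704 * z + 262144"
    unfolding s i_squared by simp
  finally show ?thesis .
qed

text \<open>
  The case \<open>J = 0\<close> is separate because it contains cubics with \<open>a\<^sup>3 = -8\<close>, for which both polynomials
  are triangles and have no \<open>j\<close>-invariant; equivalence with the Fermat cubic avoids them.
\<close>

lemma proj_equiv_Mac_Hess_iff:
  assumes f: "smooth_cubic f"
  shows "proj_equiv (Mac f) (Hess f) \<longleftrightarrow> j_inv f \<in> {0, 64, j_omega, cnj j_omega}"
proof -
  obtain a where a: "a ^ 3 \<noteq> 1" and fa: "proj_equiv f (hesse_cubic a)" by (rule hesse_normal_form_exists[OF f])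
  have jf: "j_inv f = hesse_j a" by (rule j_inv_eq_hesse_j[OF fa a])
  show ?thesis
  proof (cases "hesse_j a = 0")
    case True
    have "proj_equiv (hesse_cubic a) (hesse_cubic 0)"
      by (rule hesse_j_eq_imp_proj_equiv[OF a]) (simp_all add: True, simp add: hesse_j_def)
    then have f0: "proj_equiv f (hesse_cubic 0)" using fa proj_equiv_trans by blast
    have M: "proj_equiv (Mac f) (pencil 0 6)" using Mac_proj_equiv[OF f0] by simp
    have H: "proj_equiv (Hess f) (pencil 0 216)" using Hess_proj_equiv[OF f0] by simp
    have "proj_equiv (pencil 0 6) (Const 36 * pencil 0 6)"
      using homogeneous_pencil by (rule proj_equiv_Const_mult[rotated]) (simp_all add: pencil_eq_0_iff)
    then have "proj_equiv (pencil 0 6) (pencil 0 216)" unfolding Const_mult_pencil by simp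
    then have "proj_equiv (Mac f) (Hess f)" using M H proj_equiv_sym proj_equiv_trans by meson
    then show ?thesis by (simp add: jf True)
  next
    case False
    define b c where "b = (4 - a ^ 3) / (3 * a ^ 2)" and "c = - 2 / a"
    note jj = hesse_j_Mac_Hess[OF a False, folded b_def c_def]
    define j where "j = hesse_j a"
    have "j \<noteq> 0" using False by (simp add: j_def)
    have "a \<noteq> 0" using False by (auto simp: hesse_j_def)
    have Mc: "Const a * hesse_cubic c = pencil a 6"
      unfolding hesse_cubic_eq_pencil Const_mult_pencil pencil_inject c_def using \<open>a \<noteq> 0\<close> by simp
    have "proj_equiv (hesse_cubic c) (pencil a 6)"
      unfolding Mc[symmetric] using \<open>a \<noteq> 0\<close> smooth_hesse_cubic[OF jj(1)]
      by (intro proj_equiv_Const_mult[where d = 3]) (simp_all add: smooth_cubic_def)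
    then have M: "proj_equiv (Mac f) (hesse_cubic c)"
      using Mac_proj_equiv[OF fa a] proj_equiv_sym proj_equiv_trans by blast
    have Hb: "Const (- 54 * a ^ 2) * hesse_cubic b = pencil (- 54 * a ^ 2) (216 - 54 * a ^ 3)"
      unfolding hesse_cubic_eq_pencil Const_mult_pencil pencil_inject b_def
      using \<open>a \<noteq> 0\<close> by (simp add: field_simps power2_eq_square power3_eq_cube)
    have "proj_equiv (hesse_cubic b) (pencil (- 54 * a ^ 2) (216 - 54 * a ^ 3))"
      unfolding Hb[symmetric] using \<open>a \<noteq> 0\<close> smooth_hesse_cubic[OF jj(2)]
      by (intro proj_equiv_Const_mult[where d = 3]) (simp_all add: smooth_cubic_def)
    then have H: "proj_equiv (Hess f) (hesse_cubic b)"
      using Hess_proj_equiv[OF fa a] proj_equiv_sym proj_equiv_trans by blast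
    have "proj_equiv (Mac f) (Hess f) \<longleftrightarrow> proj_equiv (hesse_cubic c) (hesse_cubic b)"
      using M H proj_equiv_sym proj_equiv_trans by meson
    also have "\<dots> \<longleftrightarrow> hesse_j c = hesse_j b"
      using hesse_j_proj_invariant hesse_j_eq_imp_proj_equiv jj(1,2) by blast
    also have "\<dots> \<longleftrightarrow> hesse_j c * (27 * j ^ 2) = hesse_j b * (27 * j ^ 2)"
      using \<open>j \<noteq> 0\<close> by simp
    also have "hesse_j c * (27 * j ^ 2) = 4096 * 27 * j"
      using arg_cong[OF jj(3), of "\<lambda>x. x * (27 * j)"] by (simp add: j_def power2_eq_square ac_simps)
    also have "hesse_j b * (27 * j ^ 2) = (256 - j) ^ 3" using jj(4) unfolding j_def .
    also have "4096 * 27 * j = (256 - j) ^ 3 \<longleftrightarrow> (j - 64) * (j ^ 2 - 704 * j + 262144) = 0"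
    proof -
      have "4096 * 27 * j - (256 - j) ^ 3 = (j - 64) * (j ^ 2 - 704 * j + 262144)" by algebra
      then show ?thesis by (metis eq_iff_diff_eq_0)
    qed
    also have "\<dots> \<longleftrightarrow> j \<in> {0, 64, j_omega, cnj j_omega}"
      unfolding j_omega_roots[symmetric] using \<open>j \<noteq> 0\<close> by simp
    finally show ?thesis by (simp add: jf j_def)
  qed
qed

theorem proposition5p1:
  shows "card (Mac_Hess_cubics // cubic_equiv_rel) = 4 \<and>
    Mac_Hess_cubics // cubic_equiv_rel =
      (\<lambda>v. {f. smooth_cubic f \<and> j_inv f = v}) ` {0, 64, j_omega, cnj j_omega} \<and>
    (\<forall>f. smooth_cubic f \<longrightarrow>
      (proj_equiv (Mac f) (Hess f) \<longleftrightarrow> j_inv f \<in> {0, 64, j_omega, cnj j_omega}))"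
proof -
  let ?V = "{0, 64, j_omega, cnj j_omega}"
  define S where "S v = {f. smooth_cubic f \<and> j_inv f = v}" for v
  have nonempty: "\<exists>f. smooth_cubic f \<and> j_inv f = v" for v
  proof -
    obtain a where a: "a ^ 3 \<noteq> 1" "hesse_j a = v" by (rule hesse_j_surj)
    have h: "smooth_cubic (hesse_cubic a)" by (rule smooth_hesse_cubic[OF a(1)])
    then have "proj_equiv (hesse_cubic a) (hesse_cubic a)"
      unfolding smooth_cubic_def by (blast intro: proj_equiv_refl)
    then show ?thesis using h j_inv_eq_hesse_j a by blast
  qed
  have MH: "Mac_Hess_cubics = {f. smooth_cubic f \<and> j_inv f \<in> ?V}"
    unfolding Mac_Hess_cubics_def using proj_equiv_Mac_Hess_iff by blast
  have cls: "cubic_equiv_rel `` {f} = S (j_inv f)" if "smooth_cubic f" for f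
    using that proj_equiv_iff_j_inv_eq[OF that] unfolding cubic_equiv_rel_def S_def by auto
  have "Mac_Hess_cubics // cubic_equiv_rel = (\<lambda>f. cubic_equiv_rel `` {f}) ` Mac_Hess_cubics"
    by (auto simp: quotient_def)
  also have "\<dots> = (\<lambda>f. S (j_inv f)) ` Mac_Hess_cubics"
    by (rule image_cong) (auto simp: MH cls)
  also have "\<dots> = S ` (j_inv ` Mac_Hess_cubics)" by (simp add: image_image)
  also have "j_inv ` Mac_Hess_cubics = ?V"
  proof (intro equalityI subsetI)
    fix v assume v: "v \<in> ?V"
    obtain f where "smooth_cubic f" "j_inv f = v" using nonempty by blast
    then show "v \<in> j_inv ` Mac_Hess_cubics" unfolding MH using v by blast
  qed (use MH in blast)
  finally have quot: "Mac_Hess_cubics // cubic_equiv_rel = S ` ?V" .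
  have "inj_on S ?V"
  proof (rule inj_onI)
    fix v w assume "S v = S w"
    then show "v = w" using nonempty[of v] unfolding S_def by blast
  qed
  moreover have "card ?V = 4"
  proof -
    have "Re j_omega = 352" "Im j_omega = 96 * sqrt 15" by (simp_all add: j_omega_def)
    then have "j_omega \<noteq> 0" "j_omega \<noteq> 64" "cnj j_omega \<noteq> 0" "cnj j_omega \<noteq> 64" "cnj j_omega \<noteq> j_omega"
      by (auto simp: complex_eq_iff)
    then show ?thesis by auto
  qed
  ultimately have "card (Mac_Hess_cubics // cubic_equiv_rel) = 4"
    unfolding quot by (simp only: card_image)
  then show ?thesis using quot proj_equiv_Mac_Hess_iff unfolding S_def by blast
qed

end
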